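(* Let $f$ be a continuous real-valued function on $(0,\infty)$. Then each of the following conditions is equivalent to $f$ being operator monotone on $(0,\infty)$: (1) there is a symmetric operator mean $\sigma$ with $\#<\sigma$ such that $f(A\#B)\le f(A\sigma B)$ for all positive definite matrices $A,B$ (of the same, arbitrary, size); (2) there is a symmetric operator mean $\sigma$ with $\#>\sigma$ such that $f(A\#B)\ge f(A\sigma B)$ for all positive definite matrices $A,B$ (of the same, arbitrary, size).
   Context: Matrices are complex; $\le$ between Hermitian matrices is the Loewner order, and functions of Hermitian matrices are defined by functional calculus. A real function $f$ on $(0,\infty)$ is operator monotone if for every $n$ and all positive definite $n\times n$ matrices $X\le Y$ one has $f(X)\le f(Y)$. An operator mean $\sigma$ (Kubo-Ando mean) is given by its representing function $k:(0,\infty)\to(0,\infty)$, which is operator monotone with $k(1)=1$, via $A\sigma B=A^{1/2}k(A^{-1/2}BA^{-1/2})A^{1/2}$ for positive definite $A,B$. It is symmetric if $A\sigma B=B\sigma A$ for all $A,B$, equivalently $t\,k(t^{-1})=k(t)$ for all $t>0$. The geometric mean $\#$ is the operator mean with representing function $\sqrt t$, i.e. $A\#B=A^{1/2}(A^{-1/2}BA^{-1/2})^{1/2}A^{1/2}$. For operator means, $\sigma<\tau$ means that $\sigma\neq\tau$ and $A\sigma B\le A\tau B$ for all positive definite $A,B$ (equivalently, the representing functions are different and satisfy the pointwise inequality $\le$ on $(0,\infty)$). *)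

theory Defs
  imports "Jordan_Normal_Form.Schur_Decomposition"
begin

definition hermitian :: "complex mat \<Rightarrow> bool" where
  "hermitian A \<longleftrightarrow> mat_adjoint A = A"

definition unitary :: "nat \<Rightarrow> complex mat \<Rightarrow> bool" where
  "unitary n U \<longleftrightarrow> U \<in> carrier_mat n n \<and>
     U * mat_adjoint U = 1\<^sub>m n \<and> mat_adjoint U * U = 1\<^sub>m n"

text \<open>The order on \<^typ>\<open>complex\<close> used below is that of \<open>HOL-Library.Complex_Order\<close>:
  \<open>0 \<le> z\<close> says that \<open>z\<close> is real and nonnegative.\<close>

definition pos_semidef :: "complex mat \<Rightarrow> bool" where
  "pos_semidef A \<longleftrightarrow> hermitian A \<and>
     (\<forall>v \<in> carrier_vec (dim_row A). 0 \<le> (A *\<^sub>v v) \<bullet>c v)"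

definition pos_def :: "nat \<Rightarrow> complex mat \<Rightarrow> bool" where
  "pos_def n A \<longleftrightarrow> A \<in> carrier_mat n n \<and> hermitian A \<and>
     (\<forall>v \<in> carrier_vec n. v \<noteq> 0\<^sub>v n \<longrightarrow> 0 < (A *\<^sub>v v) \<bullet>c v)"

definition loewner_le :: "complex mat \<Rightarrow> complex mat \<Rightarrow> bool" (infix "\<le>\<^sub>L" 50) where
  "A \<le>\<^sub>L B \<longleftrightarrow> hermitian A \<and> hermitian B \<and> dim_row A = dim_row B \<and> pos_semidef (B - A)"

definition real_diag :: "nat \<Rightarrow> (nat \<Rightarrow> real) \<Rightarrow> complex mat" where
  "real_diag n d = mat_diag n (\<lambda>i. complex_of_real (d i))"

text \<open>Functional calculus. The result does not depend on the chosen spectral decomposition,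
  see \<open>mat_fun_spectral\<close> below.\<close>

definition mat_fun :: "(real \<Rightarrow> real) \<Rightarrow> complex mat \<Rightarrow> complex mat" where
  "mat_fun f A = (THE B. \<exists>U d. unitary (dim_row A) U \<and>
     A = U * real_diag (dim_row A) d * mat_adjoint U \<and>
     B = U * real_diag (dim_row A) (\<lambda>i. f (d i)) * mat_adjoint U)"

definition operator_monotone :: "(real \<Rightarrow> real) \<Rightarrow> bool" where
  "operator_monotone f \<longleftrightarrow>
     (\<forall>n X Y. pos_def n X \<longrightarrow> pos_def n Y \<longrightarrow> X \<le>\<^sub>L Y \<longrightarrow> mat_fun f X \<le>\<^sub>L mat_fun f Y)"

definition mean_of :: "(real \<Rightarrow> real) \<Rightarrow> complex mat \<Rightarrow> complex mat \<Rightarrow> complex mat" where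
  "mean_of k A B =
     mat_fun sqrt A *
     mat_fun k (mat_fun (\<lambda>x. 1 / sqrt x) A * B * mat_fun (\<lambda>x. 1 / sqrt x) A) *
     mat_fun sqrt A"

text \<open>A mean is a binary operation on matrices of all sizes at once; only its values at pairs of
  positive definite matrices of equal size matter.\<close>

definition operator_mean :: "(complex mat \<Rightarrow> complex mat \<Rightarrow> complex mat) \<Rightarrow> bool" where
  "operator_mean \<sigma> \<longleftrightarrow>
     (\<exists>k. operator_monotone k \<and> (\<forall>t>0. k t > 0) \<and> k 1 = 1 \<and>
        (\<forall>n A B. pos_def n A \<longrightarrow> pos_def n B \<longrightarrow> \<sigma> A B = mean_of k A B))"

definition symmetric_mean :: "(complex mat \<Rightarrow> complex mat \<Rightarrow> complex mat) \<Rightarrow> bool" where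
  "symmetric_mean \<sigma> \<longleftrightarrow> (\<forall>n A B. pos_def n A \<longrightarrow> pos_def n B \<longrightarrow> \<sigma> A B = \<sigma> B A)"

definition geometric_mean :: "complex mat \<Rightarrow> complex mat \<Rightarrow> complex mat" (infixl "\<sharp>" 70) where
  "A \<sharp> B = mean_of sqrt A B"

definition mean_less :: "(complex mat \<Rightarrow> complex mat \<Rightarrow> complex mat) \<Rightarrow>
    (complex mat \<Rightarrow> complex mat \<Rightarrow> complex mat) \<Rightarrow> bool" where
  "mean_less \<sigma> \<tau> \<longleftrightarrow>
     (\<exists>n A B. pos_def n A \<and> pos_def n B \<and> \<sigma> A B \<noteq> \<tau> A B) \<and>
     (\<forall>n A B. pos_def n A \<longrightarrow> pos_def n B \<longrightarrow> \<sigma> A B \<le>\<^sub>L \<tau> A B)"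

lemma mat_adjoint_carrier: "A \<in> carrier_mat n m \<Longrightarrow> mat_adjoint A \<in> carrier_mat m n"
  unfolding mat_adjoint_def by auto

lemma real_diag_carrier [simp]: "real_diag n d \<in> carrier_mat n n"
  by (simp add: real_diag_def mat_diag_def)

lemma real_diag_intertwine:
  assumes W: "W \<in> carrier_mat n n" and eq: "W * real_diag n d = real_diag n e * W"
  shows "W * real_diag n (\<lambda>i. f (d i)) = real_diag n (\<lambda>i. f (e i)) * W"
proof (rule eq_matI)
  fix i j assume "i < dim_row (real_diag n (\<lambda>i. f (e i)) * W)"
    and "j < dim_col (real_diag n (\<lambda>i. f (e i)) * W)"
  then have ij: "i < n" "j < n" using W by (auto simp: real_diag_def mat_diag_def)
  have "(W * real_diag n d) $$ (i, j) = (real_diag n e * W) $$ (i, j)" using eq by simp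
  then have "W $$ (i, j) = 0 \<or> d j = e i"
    using ij W by (simp add: real_diag_def mat_diag_mult_left[OF W] mat_diag_mult_right[OF W])
  then show "(W * real_diag n (\<lambda>i. f (d i))) $$ (i, j) = (real_diag n (\<lambda>i. f (e i)) * W) $$ (i, j)"
    using ij W by (auto simp: real_diag_def mat_diag_mult_left[OF W] mat_diag_mult_right[OF W])
qed (use W in \<open>auto simp: real_diag_def mat_diag_def\<close>)

lemma spectral_unique:
  assumes U: "unitary n U" and V: "unitary n V"
    and eq: "U * real_diag n d * mat_adjoint U = V * real_diag n e * mat_adjoint V"
  shows "U * real_diag n (\<lambda>i. f (d i)) * mat_adjoint U =
         V * real_diag n (\<lambda>i. f (e i)) * mat_adjoint V"
proof -
  let ?U = "mat_adjoint U" and ?V = "mat_adjoint V"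
  have c: "U \<in> carrier_mat n n" "V \<in> carrier_mat n n" "?U \<in> carrier_mat n n" "?V \<in> carrier_mat n n"
    using U V by (auto simp: unitary_def mat_adjoint_carrier)
  have u: "U * ?U = 1\<^sub>m n" "?U * U = 1\<^sub>m n" "V * ?V = 1\<^sub>m n" "?V * V = 1\<^sub>m n"
    using U V by (auto simp: unitary_def)
  have assoc: "A * B * C = A * (B * C)" if "A \<in> carrier_mat n n" "B \<in> carrier_mat n n"
    "C \<in> carrier_mat n n" for A B C :: "complex mat" using assoc_mult_mat that by blast
  have lc: "P * (Q * X) = X" if "P * Q = 1\<^sub>m n" "P \<in> carrier_mat n n" "Q \<in> carrier_mat n n"
    "X \<in> carrier_mat n n" for P Q X :: "complex mat"
    using that assoc[of P Q X] by simp
  have cl: "A * B \<in> carrier_mat n n" if "A \<in> carrier_mat n n" "B \<in> carrier_mat n n"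
    for A B :: "complex mat" using that by auto
  define W where "W = ?V * U"
  have W: "W \<in> carrier_mat n n" using c cl by (simp add: W_def)
  have "?V * (U * real_diag n d * ?U) * U = ?V * (V * real_diag n e * ?V) * U" using eq by simp
  then have "W * real_diag n d = real_diag n e * W"
    by (simp add: W_def assoc c cl u lc[OF u(4)] right_mult_one_mat[OF real_diag_carrier])
  then have "W * real_diag n (\<lambda>i. f (d i)) = real_diag n (\<lambda>i. f (e i)) * W"
    by (rule real_diag_intertwine[OF W])
  then have "V * (W * real_diag n (\<lambda>i. f (d i))) * ?U = V * (real_diag n (\<lambda>i. f (e i)) * W) * ?U"
    by simp
  then show ?thesis by (simp add: W_def assoc c cl u lc[OF u(3)] right_mult_one_mat[OF c(4)])
qed

lemma mat_fun_spectral: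
  assumes U: "unitary n U" and A: "A = U * real_diag n d * mat_adjoint U"
  shows "mat_fun f A = U * real_diag n (\<lambda>i. f (d i)) * mat_adjoint U"
proof -
  have n: "dim_row A = n" using U A by (auto simp: unitary_def)
  show ?thesis
    unfolding mat_fun_def n
  proof (rule the_equality)
    show "\<exists>U' d'. unitary n U' \<and> A = U' * real_diag n d' * mat_adjoint U' \<and>
      U * real_diag n (\<lambda>i. f (d i)) * mat_adjoint U = U' * real_diag n (\<lambda>i. f (d' i)) * mat_adjoint U'"
      using U A by blast
  qed (use U A spectral_unique in blast)
qed

end

theory Submission
  imports Defs "Jordan_Normal_Form.Spectral_Radius"
begin

text \<open>Two positive definite matrices are simultaneously of the form \<open>Q diag(d) Q\<^sup>*\<close> with \<open>Q\<close>
  invertible, and an operator mean acts on such pairs entrywise, by \<open>a * k (b / a)\<close>. Given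
  \<open># < \<sigma>\<close>, put \<open>g x = x * k (1 / x\<^sup>2)\<close>; the pair \<open>Q diag(c x) Q\<^sup>*\<close>, \<open>Q diag(c / x) Q\<^sup>*\<close> has
  geometric mean \<open>Q diag(c) Q\<^sup>*\<close> and \<open>\<sigma>\<close>-mean \<open>Q diag(c g(x)) Q\<^sup>*\<close>. Symmetry and monotonicity make \<open>k\<close>,
  hence \<open>g\<close>, continuous, so \<open>g\<close> takes all values between \<open>1\<close> and some \<open>r > 1\<close>. Thus \<open>f X \<le> f Y\<close>
  whenever \<open>X \<le> Y \<le> r X\<close>, and a finite chain of such steps joins any \<open>X \<le> Y\<close>. The case \<open># > \<sigma>\<close> is
  the same with values of \<open>g\<close> below \<open>1\<close>. Conversely, the arithmetic and harmonic means serve as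
  witnesses.\<close>

section \<open>Adjoints and the spectral theorem\<close>

text \<open>Associativity and closure with all dimensions fixed to \<open>n\<close>, so that
  simplification never has to guess the dimensions in the carrier premises.\<close>

lemmas square_mat = assoc_mult_mat[of _ n n _ n _ n] mult_carrier_mat[of _ n n _ n] for n

lemma mat_adjoint_eq: "mat_adjoint (A :: complex mat) = map_mat cnj (transpose_mat A)"
  by (rule eq_matI) (auto simp: mat_adjoint_def mat_of_rows_index)

lemma mat_adjoint_dim [simp]:
  "dim_row (mat_adjoint (A :: complex mat)) = dim_col A" "dim_col (mat_adjoint A) = dim_row A"
  by (auto simp: mat_adjoint_eq)

lemma mat_adjoint_index [simp]:
  "i < dim_col A \<Longrightarrow> j < dim_row A \<Longrightarrow> mat_adjoint (A :: complex mat) $$ (i, j) = cnj (A $$ (j, i))"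
  by (simp add: mat_adjoint_eq)

lemma mat_adjoint_adjoint [simp]: "mat_adjoint (mat_adjoint (A :: complex mat)) = A"
  by (rule eq_matI) auto

lemma mat_adjoint_mult:
  assumes "A \<in> carrier_mat n m" "B \<in> carrier_mat m l"
  shows "mat_adjoint (A * B :: complex mat) = mat_adjoint B * mat_adjoint A"
  by (rule eq_matI) (use assms in \<open>auto simp: scalar_prod_def mult.commute\<close>)

lemma mat_adjoint_one [simp]: "mat_adjoint (1\<^sub>m n :: complex mat) = 1\<^sub>m n"
  by (rule eq_matI) auto

lemma mat_adjoint_real_diag [simp]: "mat_adjoint (real_diag n d) = real_diag n d"
  by (rule eq_matI) (auto simp: real_diag_def mat_diag_def)

lemma mat_adjoint_minus:
  assumes "A \<in> carrier_mat n m" "B \<in> carrier_mat n m"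
  shows "mat_adjoint (A - B :: complex mat) = mat_adjoint A - mat_adjoint B"
  by (rule eq_matI) (use assms in auto)

lemma mat_adjoint_smult_real:
  "mat_adjoint (of_real c \<cdot>\<^sub>m A :: complex mat) = of_real c \<cdot>\<^sub>m mat_adjoint A"
  by (rule eq_matI) auto

lemma mat_adjoint_four_block:
  assumes "A \<in> carrier_mat n n" "B \<in> carrier_mat n m" "C \<in> carrier_mat m n" "D \<in> carrier_mat m m"
  shows "mat_adjoint (four_block_mat A B C D :: complex mat) =
    four_block_mat (mat_adjoint A) (mat_adjoint C) (mat_adjoint B) (mat_adjoint D)"
  by (rule eq_matI) (use assms in auto)

lemma real_diag_index [simp]:
  "dim_row (real_diag n d) = n" "dim_col (real_diag n d) = n"
  "i < n \<Longrightarrow> j < n \<Longrightarrow> real_diag n d $$ (i, j) = (if i = j then of_real (d i) else 0)"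
  by (simp_all add: real_diag_def mat_diag_def)

lemma real_diag_mult: "real_diag n a * real_diag n b = real_diag n (\<lambda>i. a i * b i)"
  by (simp add: real_diag_def)

lemma real_diag_one: "real_diag n (\<lambda>_. 1) = 1\<^sub>m n"
  by (simp add: real_diag_def)

lemma real_diag_cong: "(\<And>i. i < n \<Longrightarrow> a i = b i) \<Longrightarrow> real_diag n a = real_diag n b"
  by (rule eq_matI) (auto simp: real_diag_def mat_diag_def)

section \<open>Unitary matrices and diagonalization of Hermitian matrices\<close>

lemma unitaryI:
  assumes "U \<in> carrier_mat n n" "mat_adjoint U * U = 1\<^sub>m n"
  shows "unitary n U"
  using assms mat_mult_left_right_inverse[of "mat_adjoint U" n U]
  by (simp add: unitary_def mat_adjoint_carrier)

lemma unitary_mult: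
  assumes "unitary n U" "unitary n V"
  shows "unitary n (U * V)"
proof (rule unitaryI)
  have c: "U \<in> carrier_mat n n" "V \<in> carrier_mat n n" and u: "mat_adjoint U * U = 1\<^sub>m n"
    "mat_adjoint V * V = 1\<^sub>m n"
    using assms by (auto simp: unitary_def)
  note c' = c mat_adjoint_carrier[OF c(1)] mat_adjoint_carrier[OF c(2)]
  show "U * V \<in> carrier_mat n n" using c by simp
  have "mat_adjoint (U * V) * (U * V) = mat_adjoint V * ((mat_adjoint U * U) * V)"
    using c' by (simp add: mat_adjoint_mult[OF c] square_mat[where n = n])
  then show "mat_adjoint (U * V) * (U * V) = 1\<^sub>m n" using c u by simp
qed

text \<open>Complete \<open>v\<close> to a basis and orthogonalize: Gram-Schmidt keeps the first
  vector, and normalizing the results gives the columns. This supplies the change of basis in the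
  inductive step of the spectral theorem.\<close>

lemma unitary_extension:
  fixes v :: "complex vec"
  assumes v: "v \<in> carrier_vec n" "v \<noteq> 0\<^sub>v n" and n: "n > 0"
  shows "\<exists>U c. unitary n U \<and> col U 0 = c \<cdot>\<^sub>v v"
proof -
  define b where "b = basis_completion v"
  define ws where "ws = gram_schmidt n b"
  note b = vec_space.basis_completion[OF v, folded b_def]
  from b(6,7) n obtain vs where bv: "b = v # vs" by (cases b) auto
  from cof_vec_space.gram_schmidt_result[OF b(2,4,5) refl, folded ws_def]
  have ws: "set ws \<subseteq> carrier_vec n" "corthogonal ws" "length ws = n"
    using b(6) by auto
  from cof_vec_space.gram_schmidt_hd[OF v(1), of vs, folded bv] have hdws: "hd ws = v" unfolding ws_def .
  have wsc: "ws ! i \<in> carrier_vec n" if "i < n" for i using that ws by auto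
  \<comment> \<open>\<open>gram_schmidt\<close> gives orthogonal vectors without normalizing them;
    \<open>N i\<close> is the Euclidean norm by which column \<open>i\<close> is divided.\<close>
  define N where "N i = sqrt (\<Sum>j<n. (cmod (ws ! i $ j))\<^sup>2)" for i
  have sq: "ws ! i \<bullet>c ws ! i = complex_of_real ((N i)\<^sup>2)" if "i < n" for i
    using wsc[OF that]
    by (simp add: N_def scalar_prod_def sum_nonneg lessThan_atLeast0 complex_norm_square
        del: of_real_power)
  have N0: "N i \<noteq> 0" if "i < n" for i
    using corthogonalD[OF ws(2), of i i] that ws(3) sq[OF that] by auto
  define U where "U = mat n n (\<lambda>(i, j). ws ! j $ i / of_real (N j))"
  have U: "U \<in> carrier_mat n n" by (simp add: U_def)
  have "mat_adjoint U * U = 1\<^sub>m n"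
  proof (rule eq_matI)
    fix i j assume "i < dim_row (1\<^sub>m n)" "j < dim_col (1\<^sub>m n)"
    then have ij: "i < n" "j < n" by auto
    have "(mat_adjoint U * U) $$ (i, j) =
        (\<Sum>l<n. ws ! j $ l * cnj (ws ! i $ l)) / (of_real (N i) * of_real (N j))"
      using ij by (auto simp: U_def scalar_prod_def sum_divide_distrib mult.commute
          lessThan_atLeast0 intro!: sum.cong)
    also have "(\<Sum>l<n. ws ! j $ l * cnj (ws ! i $ l)) = ws ! j \<bullet>c ws ! i"
      using wsc[OF ij(1)] wsc[OF ij(2)]
      by (auto simp: scalar_prod_def lessThan_atLeast0 intro!: sum.cong)
    also have "\<dots> / (of_real (N i) * of_real (N j)) = 1\<^sub>m n $$ (i, j)"
      using corthogonalD[OF ws(2), of j i] sq[OF ij(1)] N0[OF ij(1)] ij ws(3)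
      by (auto simp: power2_eq_square)
    finally show "(mat_adjoint U * U) $$ (i, j) = 1\<^sub>m n $$ (i, j)" .
  qed (auto simp: U_def)
  then have "unitary n U" using U by (rule unitaryI[rotated])
  moreover have "col U 0 = (1 / of_real (N 0)) \<cdot>\<^sub>v v"
  proof -
    have "ws ! 0 = v" using n ws(3) hdws by (cases ws) auto
    then show ?thesis using n v(1) by (intro eq_vecI) (auto simp: U_def)
  qed
  ultimately show ?thesis by blast
qed

text \<open>Induction by deflation: a unitary whose first column is an eigenvector splits off a
  one-dimensional block, and the remaining block of size \<open>m\<close> is again
  Hermitian.\<close>

theorem hermitian_spectral:
  assumes "A \<in> carrier_mat n n" "hermitian A"
  shows "\<exists>U d. unitary n U \<and> A = U * real_diag n d * mat_adjoint U"
  using assms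
proof (induction n arbitrary: A)
  case 0
  then have "A = 1\<^sub>m 0 * real_diag 0 (\<lambda>_. 0) * mat_adjoint (1\<^sub>m 0)" by (intro eq_matI) auto
  moreover have "unitary 0 (1\<^sub>m 0)" by (rule unitaryI) auto
  ultimately show ?case by blast
next
  case (Suc m)
  let ?n = "Suc m"
  note A = Suc.prems(1)
  from spectrum_non_empty[OF A] obtain l v where "eigenvector A v l"
    by (auto simp: spectrum_def eigenvalue_def)
  with A have v: "v \<in> carrier_vec ?n" "v \<noteq> 0\<^sub>v ?n" and Av: "A *\<^sub>v v = l \<cdot>\<^sub>v v"
    by (auto simp: eigenvector_def)
  from unitary_extension[OF v] obtain U c where U: "unitary ?n U" and U0: "col U 0 = c \<cdot>\<^sub>v v" by auto
  let ?U = "mat_adjoint U"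
  have c: "U \<in> carrier_mat ?n ?n" "?U \<in> carrier_mat ?n ?n" and u: "?U * U = 1\<^sub>m ?n" "U * ?U = 1\<^sub>m ?n"
    using U by (auto simp: unitary_def mat_adjoint_carrier)
  note assoc = square_mat[where n = ?n]
  have u0: "col U 0 \<in> carrier_vec ?n" using v by (simp add: U0)
  define B where "B = ?U * A * U"
  have B: "B \<in> carrier_mat ?n ?n" using A c by (simp add: B_def)
  have Bh: "mat_adjoint B = B"
    using Suc.prems c by (simp add: B_def hermitian_def mat_adjoint_mult[of _ ?n ?n _ ?n] assoc)
  \<comment> \<open>The first column of \<open>U\<close> is an eigenvector of \<open>A\<close> for
    \<open>l\<close>, and the adjoint of \<open>U\<close> sends it to the first unit vector.\<close>
  have col_B: "col B 0 = l \<cdot>\<^sub>v unit_vec ?n 0"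
  proof -
    have "col B 0 = (?U * A) *\<^sub>v col U 0"
      unfolding B_def by (rule col_mult2[of _ ?n ?n _ ?n]) (use A c in auto)
    also have "\<dots> = ?U *\<^sub>v (A *\<^sub>v col U 0)"
      by (rule assoc_mult_mat_vec[OF c(2) A u0])
    also have "\<dots> = ?U *\<^sub>v (A *\<^sub>v (c \<cdot>\<^sub>v v))" by (simp add: U0)
    also have "A *\<^sub>v (c \<cdot>\<^sub>v v) = l \<cdot>\<^sub>v col U 0"
      unfolding U0 mult_mat_vec[OF A v(1)] Av smult_smult_assoc by (simp add: mult.commute)
    also have "?U *\<^sub>v \<dots> = l \<cdot>\<^sub>v col (?U * U) 0"
      by (simp only: mult_mat_vec[OF c(2) u0] col_mult2[OF c(2) c(1) zero_less_Suc])
    finally show ?thesis by (simp add: u)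
  qed
  have B0: "B $$ (i, 0) = (if i = 0 then l else 0)" if "i < ?n" for i
  proof -
    have "B $$ (i, 0) = col B 0 $ i" using B that by simp
    also have "\<dots> = (if i = 0 then l else 0)" unfolding col_B using that by simp
    finally show ?thesis .
  qed
  have Bij: "B $$ (i, j) = cnj (B $$ (j, i))" if "i < ?n" "j < ?n" for i j
    using Bh B that by (metis carrier_matD mat_adjoint_index)
  \<comment> \<open>The diagonal entry \<open>l\<close> of the Hermitian matrix \<open>B\<close>
    equals its own conjugate.\<close>
  have l: "of_real (Re l) = l"
    using Bij[of 0 0] B0[of 0] by (simp add: complex_eq_iff)
  have B0': "B $$ (0, j) = (if j = 0 then l else 0)" if "j < ?n" for j
    using Bij[of 0 j] B0[of j] that l by (metis complex_cnj_complex_of_real complex_cnj_zero zero_less_Suc)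
  define D where "D = mat m m (\<lambda>(i, j). B $$ (Suc i, Suc j))"
  have D: "D \<in> carrier_mat m m" by (simp add: D_def)
  have "hermitian D"
    unfolding hermitian_def by (rule eq_matI) (auto simp: D_def intro: Bij[symmetric])
  with Suc.IH[OF D] obtain V d where V: "unitary m V" and DV: "D = V * real_diag m d * mat_adjoint V"
    by blast
  have cV: "V \<in> carrier_mat m m" "mat_adjoint V \<in> carrier_mat m m" and uV: "mat_adjoint V * V = 1\<^sub>m m"
    using V by (auto simp: unitary_def mat_adjoint_carrier)
  \<comment> \<open>Padding \<open>V\<close> with a \<open>1\<close> in the upper left corner
    diagonalizes the block \<open>D\<close> and leaves the first coordinate fixed.\<close>
  define F where "F = four_block_mat (1\<^sub>m 1) (0\<^sub>m 1 m) (0\<^sub>m m 1) V"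
  have F: "F \<in> carrier_mat ?n ?n" by (rule carrier_matI) (use cV in \<open>simp_all add: F_def\<close>)
  have z: "mat_adjoint (0\<^sub>m p q) = (0\<^sub>m q p :: complex mat)" for p q by (rule eq_matI) auto
  have Fa: "mat_adjoint F = four_block_mat (1\<^sub>m 1) (0\<^sub>m 1 m) (0\<^sub>m m 1) (mat_adjoint V)"
    using mat_adjoint_four_block[of "1\<^sub>m 1" 1 "0\<^sub>m 1 m" m "0\<^sub>m m 1" V] cV by (simp add: F_def z)
  have blk: "four_block_mat A1 (0\<^sub>m p m) (0\<^sub>m m p) X * four_block_mat A2 (0\<^sub>m p m) (0\<^sub>m m p) Y =
      four_block_mat (A1 * A2) (0\<^sub>m p m) (0\<^sub>m m p) (X * Y)"
    if "A1 \<in> carrier_mat p p" "A2 \<in> carrier_mat p p" "X \<in> carrier_mat m m" "Y \<in> carrier_mat m m"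
    for p and A1 A2 X Y :: "complex mat"
    by (subst mult_four_block_mat[of _ p p _ m _ m _ _ p _ m]) (use that in simp_all)
  have uF: "unitary ?n F"
  proof (rule unitaryI[OF F])
    have "mat_adjoint F * F = four_block_mat (1\<^sub>m 1) (0\<^sub>m 1 m) (0\<^sub>m m 1) (1\<^sub>m m)"
      unfolding Fa unfolding F_def using cV by (simp add: blk uV)
    then show "mat_adjoint F * F = 1\<^sub>m ?n" using four_block_one_mat[of 1 m] by simp
  qed
  define e where "e i = (if i = 0 then Re l else d (i - 1))" for i
  have "B = four_block_mat (real_diag 1 (\<lambda>_. Re l)) (0\<^sub>m 1 m) (0\<^sub>m m 1) D"
  proof (rule eq_matI)
    fix i j assume "i < dim_row (four_block_mat (real_diag 1 (\<lambda>_. Re l)) (0\<^sub>m 1 m) (0\<^sub>m m 1) D)"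
      "j < dim_col (four_block_mat (real_diag 1 (\<lambda>_. Re l)) (0\<^sub>m 1 m) (0\<^sub>m m 1) D)"
    then have ij: "i < ?n" "j < ?n" using D by simp_all
    show "B $$ (i, j) = four_block_mat (real_diag 1 (\<lambda>_. Re l)) (0\<^sub>m 1 m) (0\<^sub>m m 1) D $$ (i, j)"
      using ij D B0[OF ij(1)] B0'[OF ij(2)] l by (cases i; cases j) (simp_all add: D_def)
  qed (use B D in simp_all)
  also have "\<dots> = F * four_block_mat (real_diag 1 (\<lambda>_. Re l)) (0\<^sub>m 1 m) (0\<^sub>m m 1) (real_diag m d) * mat_adjoint F"
    unfolding Fa unfolding F_def DV using cV left_mult_one_mat[OF real_diag_carrier]
      right_mult_one_mat[OF real_diag_carrier] by (simp add: blk)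
  also have "four_block_mat (real_diag 1 (\<lambda>_. Re l)) (0\<^sub>m 1 m) (0\<^sub>m m 1) (real_diag m d) = real_diag ?n e"
  proof (rule eq_matI)
    fix i j assume "i < dim_row (real_diag ?n e)" "j < dim_col (real_diag ?n e)"
    then have "i < ?n" "j < ?n" by simp_all
    then show "four_block_mat (real_diag 1 (\<lambda>_. Re l)) (0\<^sub>m 1 m) (0\<^sub>m m 1) (real_diag m d) $$ (i, j) =
        real_diag ?n e $$ (i, j)"
      by (cases i; cases j) (simp_all add: e_def)
  qed simp_all
  finally have BF: "B = F * real_diag ?n e * mat_adjoint F" .
  have "U * B * ?U = (U * ?U) * A * (U * ?U)"
    using A c by (simp add: B_def assoc)
  then have "A = U * B * ?U" using A u by simp
  also have "\<dots> = (U * F) * real_diag ?n e * mat_adjoint (U * F)"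
    using c F mat_adjoint_carrier[OF F] by (simp add: BF mat_adjoint_mult[OF c(1) F] assoc)
  finally show ?case using unitary_mult[OF U uF] by blast
qed

section \<open>Congruences of diagonal matrices\<close>

text \<open>A congruence rather than a similarity: unitary \<open>Q\<close> gives a spectral
  decomposition, while merely invertible \<open>Q\<close> allows two matrices to share it. The
  values of \<open>d\<close> are called weights below.\<close>

definition cdiag :: "nat \<Rightarrow> complex mat \<Rightarrow> (nat \<Rightarrow> real) \<Rightarrow> complex mat" where
  "cdiag n Q d = Q * real_diag n d * mat_adjoint Q"

lemma cdiag_carrier: "Q \<in> carrier_mat n n \<Longrightarrow> cdiag n Q d \<in> carrier_mat n n"
  by (simp add: cdiag_def mat_adjoint_carrier square_mat[where n = n])

lemma cdiag_cong: "(\<And>i. i < n \<Longrightarrow> a i = b i) \<Longrightarrow> cdiag n Q a = cdiag n Q b"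
  using real_diag_cong[of n a b] by (simp add: cdiag_def)

lemma cdiag_mult:
  assumes "P \<in> carrier_mat n n" "Q \<in> carrier_mat n n"
  shows "cdiag n (P * Q) d = P * cdiag n Q d * mat_adjoint P"
  using assms mat_adjoint_carrier[OF assms(1)] mat_adjoint_carrier[OF assms(2)]
  by (simp add: cdiag_def mat_adjoint_mult[OF assms] square_mat[where n = n])

text \<open>Scaling the columns of \<open>Q\<close> moves positive weights into \<open>Q\<close> and
  back; with square roots as scale factors the weights can be normalized to
  \<open>1\<close>.\<close>

lemma cdiag_real_diag:
  assumes "Q \<in> carrier_mat n n"
  shows "cdiag n (Q * real_diag n a) d = cdiag n Q (\<lambda>i. (a i)\<^sup>2 * d i)"
proof -
  have "real_diag n (\<lambda>i. (a i)\<^sup>2 * d i) = real_diag n a * real_diag n d * real_diag n a"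
    by (simp add: real_diag_mult power2_eq_square mult_ac)
  then show ?thesis
    using assms mat_adjoint_carrier[OF assms]
    by (simp add: cdiag_def mat_adjoint_mult[OF assms real_diag_carrier] square_mat[where n = n])
qed

lemma cdiag_hermitian:
  assumes "Q \<in> carrier_mat n n"
  shows "hermitian (cdiag n Q d)"
  unfolding hermitian_def cdiag_def using assms mat_adjoint_carrier[OF assms]
  by (simp add: mat_adjoint_mult[of _ n n _ n] square_mat[where n = n])

lemma real_diag_affine:
  "real_diag n (\<lambda>i. a * d i + b * e i) = of_real a \<cdot>\<^sub>m real_diag n d + of_real b \<cdot>\<^sub>m real_diag n e"
  by (rule eq_matI) (auto simp: real_diag_def mat_diag_def)

lemma cdiag_affine:
  assumes "Q \<in> carrier_mat n n"
  shows "cdiag n Q (\<lambda>i. a * d i + b * e i) = of_real a \<cdot>\<^sub>m cdiag n Q d + of_real b \<cdot>\<^sub>m cdiag n Q e"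
  using assms mat_adjoint_carrier[OF assms]
  by (simp add: cdiag_def real_diag_affine mult_add_distrib_mat[of _ n n _ n] add_mult_distrib_mat[of _ n n _ _ n]
     mult_carrier_mat[of _ n n _ n]
      mult_smult_distrib[of _ n n _ n] mult_smult_assoc_mat[of _ n n _ n])

lemma cdiag_diff:
  assumes "Q \<in> carrier_mat n n"
  shows "cdiag n Q b - cdiag n Q a = cdiag n Q (\<lambda>i. b i - a i)"
  using cdiag_affine[OF assms, of 1 b "-1" a] cdiag_carrier[OF assms, of a] cdiag_carrier[OF assms, of b]
  by (auto intro!: eq_matI)

lemma adjoint_cscalar:
  fixes v w :: "complex vec"
  assumes "M \<in> carrier_mat n n" "v \<in> carrier_vec n" "w \<in> carrier_vec n"
  shows "(M *\<^sub>v v) \<bullet>c w = v \<bullet>c (mat_adjoint M *\<^sub>v w)"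
proof -
  have "(M *\<^sub>v v) \<bullet>c w = (\<Sum>i<n. \<Sum>j<n. M $$ (i, j) * v $ j * cnj (w $ i))"
    using assms by (simp add: scalar_prod_def lessThan_atLeast0 sum_distrib_right)
  also have "\<dots> = (\<Sum>j<n. \<Sum>i<n. M $$ (i, j) * v $ j * cnj (w $ i))" by (rule sum.swap)
  also have "\<dots> = v \<bullet>c (mat_adjoint M *\<^sub>v w)"
    using assms by (simp add: scalar_prod_def lessThan_atLeast0 sum_distrib_left ac_simps)
  finally show ?thesis .
qed

text \<open>Moving \<open>Q\<close> to the other side of the scalar product leaves a diagonal form
  in the vector \<open>mat_adjoint Q *\<^sub>v v\<close>.\<close>

lemma cdiag_quadratic_form:
  assumes Q: "Q \<in> carrier_mat n n" and v: "v \<in> carrier_vec n"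
  shows "(cdiag n Q d *\<^sub>v v) \<bullet>c v =
    complex_of_real (\<Sum>i<n. d i * (cmod ((mat_adjoint Q *\<^sub>v v) $ i))\<^sup>2)"
proof -
  note Q' = mat_adjoint_carrier[OF Q]
  define w where "w = mat_adjoint Q *\<^sub>v v"
  have w: "w \<in> carrier_vec n" using Q' v by (simp add: w_def)
  have dw: "real_diag n d *\<^sub>v w \<in> carrier_vec n" by (rule mult_mat_vec_carrier[OF real_diag_carrier w])
  have "(cdiag n Q d *\<^sub>v v) = Q *\<^sub>v (real_diag n d *\<^sub>v w)"
    using Q Q' v by (simp add: cdiag_def w_def assoc_mult_mat_vec[of _ n n _ n])
  then have "(cdiag n Q d *\<^sub>v v) \<bullet>c v = (real_diag n d *\<^sub>v w) \<bullet>c w"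
    using adjoint_cscalar[OF Q dw v] by (simp add: w_def)
  also have "real_diag n d *\<^sub>v w = vec n (\<lambda>i. of_real (d i) * w $ i)"
    using w by (intro eq_vecI)
      (auto simp: real_diag_def mat_diag_def scalar_prod_def if_distrib[of "\<lambda>x. x * _"] cong: if_cong)
  also have "\<dots> \<bullet>c w = complex_of_real (\<Sum>i<n. d i * (cmod (w $ i))\<^sup>2)"
    using w by (auto simp: scalar_prod_def lessThan_atLeast0 complex_norm_square mult_ac
        simp del: of_real_power intro!: sum.cong)
  finally show ?thesis by (simp add: w_def)
qed

lemma cdiag_pos_semidef:
  assumes Q: "Q \<in> carrier_mat n n" and d: "\<And>i. i < n \<Longrightarrow> d i \<ge> 0"
  shows "pos_semidef (cdiag n Q d)"
  using cdiag_hermitian[OF Q, of d] cdiag_carrier[OF Q, of d] d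
  by (auto simp: pos_semidef_def cdiag_quadratic_form[OF Q] less_eq_complex_def intro!: sum_nonneg)

lemma cdiag_le:
  assumes Q: "Q \<in> carrier_mat n n" and le: "\<And>i. i < n \<Longrightarrow> a i \<le> b i"
  shows "cdiag n Q a \<le>\<^sub>L cdiag n Q b"
  using cdiag_pos_semidef[OF Q, of "\<lambda>i. b i - a i"] cdiag_carrier[OF Q, of a] cdiag_carrier[OF Q, of b] le
  by (simp add: loewner_le_def cdiag_hermitian[OF Q] cdiag_diff[OF Q])

section \<open>Invertible congruences, positivity and the Loewner order\<close>

lemma mult_mat_zero_vec: "M \<in> carrier_mat m n \<Longrightarrow> M *\<^sub>v 0\<^sub>v n = (0\<^sub>v m :: complex vec)"
  by (intro eq_vecI) (auto simp: scalar_prod_def)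

text \<open>The inverse is carried along as an explicit matrix, so that inverses of products,
  adjoints and congruences can be written down directly.\<close>

definition inverse_pair :: "nat \<Rightarrow> complex mat \<Rightarrow> complex mat \<Rightarrow> bool" where
  "inverse_pair n Q R \<longleftrightarrow> Q \<in> carrier_mat n n \<and> R \<in> carrier_mat n n \<and> Q * R = 1\<^sub>m n \<and> R * Q = 1\<^sub>m n"

lemma inverse_pair_adjoint:
  assumes "inverse_pair n Q R"
  shows "inverse_pair n (mat_adjoint Q) (mat_adjoint R)"
proof -
  have c: "Q \<in> carrier_mat n n" "R \<in> carrier_mat n n" and e: "Q * R = 1\<^sub>m n" "R * Q = 1\<^sub>m n"
    using assms by (auto simp: inverse_pair_def)
  have "mat_adjoint Q * mat_adjoint R = 1\<^sub>m n" "mat_adjoint R * mat_adjoint Q = 1\<^sub>m n"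
    unfolding mat_adjoint_mult[OF c(2,1), symmetric] mat_adjoint_mult[OF c, symmetric] e by simp_all
  then show ?thesis using c by (simp add: inverse_pair_def mat_adjoint_carrier)
qed

lemma inverse_pair_mult:
  assumes "inverse_pair n Q R" "inverse_pair n Q' R'"
  shows "inverse_pair n (Q * Q') (R' * R)"
proof -
  have c: "Q \<in> carrier_mat n n" "R \<in> carrier_mat n n" "Q' \<in> carrier_mat n n" "R' \<in> carrier_mat n n"
    and e: "Q * R = 1\<^sub>m n" "R * Q = 1\<^sub>m n" "Q' * R' = 1\<^sub>m n" "R' * Q' = 1\<^sub>m n"
    using assms by (auto simp: inverse_pair_def)
  have "Q * Q' * (R' * R) = Q * ((Q' * R') * R)" "R' * R * (Q * Q') = R' * ((R * Q) * Q')"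
    using c by (simp_all add: square_mat[where n = n])
  then show ?thesis using c e by (simp add: inverse_pair_def)
qed

lemma inverse_pair_real_diag:
  assumes "\<And>i. i < n \<Longrightarrow> d i \<noteq> 0"
  shows "inverse_pair n (real_diag n d) (real_diag n (\<lambda>i. 1 / d i))"
  using real_diag_cong[of n "\<lambda>i. d i * (1 / d i)" "\<lambda>_. 1"] real_diag_cong[of n "\<lambda>i. 1 / d i * d i" "\<lambda>_. 1"] assms
  by (simp add: inverse_pair_def real_diag_mult real_diag_one)

lemma inverse_pair_unitary: "unitary n U \<Longrightarrow> inverse_pair n U (mat_adjoint U)"
  by (auto simp: inverse_pair_def unitary_def mat_adjoint_carrier)

lemma inverse_pair_one: "inverse_pair n (1\<^sub>m n) (1\<^sub>m n)"
  by (simp add: inverse_pair_def)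

lemma inverse_pair_unique:
  assumes "inverse_pair n Q R" "inverse_pair n Q R'"
  shows "R = R'"
proof -
  have c: "Q \<in> carrier_mat n n" "R \<in> carrier_mat n n" "R' \<in> carrier_mat n n"
    and e: "R * Q = 1\<^sub>m n" "Q * R' = 1\<^sub>m n"
    using assms by (auto simp: inverse_pair_def)
  have "R = R * (Q * R')" using c by (simp only: e right_mult_one_mat)
  also have "\<dots> = R * Q * R'" using c by (simp add: assoc_mult_mat[of _ n n _ n _ n])
  also have "\<dots> = R'" using c by (simp only: e left_mult_one_mat)
  finally show ?thesis .
qed

text \<open>Inverting the product reverses its factors, so the inverse is a congruence by the
  adjoint of \<open>R\<close>, not by \<open>R\<close>.\<close>

lemma cdiag_inverse:
  assumes Q: "inverse_pair n Q R" and d: "\<And>i. i < n \<Longrightarrow> d i \<noteq> 0"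
  shows "inverse_pair n (cdiag n Q d) (cdiag n (mat_adjoint R) (\<lambda>i. 1 / d i))"
proof -
  have "R \<in> carrier_mat n n" using Q by (simp add: inverse_pair_def)
  then show ?thesis
    using inverse_pair_mult[OF inverse_pair_mult[OF Q inverse_pair_real_diag[OF d]] inverse_pair_adjoint[OF Q]]
      mat_adjoint_carrier[of R n n]
    by (simp add: cdiag_def square_mat[where n = n])
qed

text \<open>The adjoint of \<open>Q\<close> is injective, so a nonzero \<open>v\<close> has a
  nonzero coordinate after it is applied; that coordinate contributes a strictly positive
  term.\<close>

lemma cdiag_pos_def:
  assumes Q: "inverse_pair n Q R" and d: "\<And>i. i < n \<Longrightarrow> d i > 0"
  shows "pos_def n (cdiag n Q d)"
proof -
  have c: "Q \<in> carrier_mat n n" using Q by (simp add: inverse_pair_def)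
  note Q' = inverse_pair_adjoint[OF Q]
  have "0 < (\<Sum>i<n. d i * (cmod ((mat_adjoint Q *\<^sub>v v) $ i))\<^sup>2)"
    if v: "v \<in> carrier_vec n" "v \<noteq> 0\<^sub>v n" for v
  proof -
    have "mat_adjoint Q *\<^sub>v v \<noteq> 0\<^sub>v n"
    proof
      assume z: "mat_adjoint Q *\<^sub>v v = 0\<^sub>v n"
      have "v = (mat_adjoint R * mat_adjoint Q) *\<^sub>v v" using Q' v by (simp add: inverse_pair_def)
      also have "\<dots> = mat_adjoint R *\<^sub>v (mat_adjoint Q *\<^sub>v v)"
        using Q' v by (intro assoc_mult_mat_vec) (auto simp: inverse_pair_def)
      also have "\<dots> = 0\<^sub>v n" unfolding z using Q' by (auto simp: inverse_pair_def mult_mat_zero_vec)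
      finally show False using v by simp
    qed
    then obtain i where i: "i < n" "(mat_adjoint Q *\<^sub>v v) $ i \<noteq> 0"
      using c v by (metis (no_types, lifting) carrier_matD(2) dim_mult_mat_vec eq_vecI index_zero_vec mat_adjoint_dim(1))
    show ?thesis
      by (rule sum_pos2[where i = i]) (use i d in \<open>auto intro!: mult_pos_pos mult_nonneg_nonneg simp: less_imp_le\<close>)
  qed
  then show ?thesis
    using cdiag_carrier[OF c, of d] cdiag_hermitian[OF c, of d]
    by (auto simp: pos_def_def cdiag_quadratic_form[OF c] less_complex_def)
qed

text \<open>Testing the form on the vector that \<open>mat_adjoint Q\<close> maps to a unit vector reads off an entry.\<close>

lemma cdiag_entry:
  assumes Q: "inverse_pair n Q R" and i: "i < n"
  shows "\<exists>v \<in> carrier_vec n. v \<noteq> 0\<^sub>v n \<and> (\<forall>d. (cdiag n Q d *\<^sub>v v) \<bullet>c v = complex_of_real (d i))"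
proof -
  have c: "Q \<in> carrier_mat n n" using Q by (simp add: inverse_pair_def)
  note Q' = inverse_pair_adjoint[OF Q]
  define v where "v = mat_adjoint R *\<^sub>v unit_vec n i"
  have v: "v \<in> carrier_vec n" using Q' by (auto simp: v_def inverse_pair_def)
  have "mat_adjoint Q *\<^sub>v v = (mat_adjoint Q * mat_adjoint R) *\<^sub>v unit_vec n i"
    unfolding v_def using Q' by (intro assoc_mult_mat_vec[symmetric]) (auto simp: inverse_pair_def)
  then have e: "mat_adjoint Q *\<^sub>v v = unit_vec n i" using Q' by (simp add: inverse_pair_def)
  have "v \<noteq> 0\<^sub>v n"
  proof
    assume "v = 0\<^sub>v n"
    then have "mat_adjoint Q *\<^sub>v v = 0\<^sub>v n"
      using Q' by (auto simp: inverse_pair_def mult_mat_zero_vec)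
    with e have "unit_vec n i $ i = (0\<^sub>v n $ i :: complex)" by simp
    then show False using i by simp
  qed
  moreover have "(cdiag n Q d *\<^sub>v v) \<bullet>c v = complex_of_real (d i)" for d
  proof -
    have "(\<Sum>j<n. d j * (cmod (unit_vec n i $ j))\<^sup>2) = (\<Sum>j<n. if j = i then d j else 0)"
      using i by (intro sum.cong) auto
    then show ?thesis using i by (simp add: cdiag_quadratic_form[OF c v] e)
  qed
  ultimately show ?thesis using v by blast
qed

lemma cdiag_pos_def_iff:
  assumes Q: "inverse_pair n Q R"
  shows "pos_def n (cdiag n Q d) \<longleftrightarrow> (\<forall>i<n. d i > 0)"
proof
  assume pd: "pos_def n (cdiag n Q d)"
  show "\<forall>i<n. d i > 0"
  proof (intro allI impI)
    fix i assume "i < n"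
    from cdiag_entry[OF Q this] obtain v where "v \<in> carrier_vec n" "v \<noteq> 0\<^sub>v n"
      "(cdiag n Q d *\<^sub>v v) \<bullet>c v = complex_of_real (d i)" by blast
    with pd show "d i > 0" by (auto simp: pos_def_def less_complex_def)
  qed
qed (use cdiag_pos_def[OF Q] in blast)

text \<open>The difference is a congruence by the same \<open>Q\<close>, and the vectors from
  \<open>cdiag_entry\<close> isolate its weights. Matrix inequalities thereby become scalar
  ones.\<close>

lemma cdiag_le_iff:
  assumes Q: "inverse_pair n Q R"
  shows "cdiag n Q a \<le>\<^sub>L cdiag n Q b \<longleftrightarrow> (\<forall>i<n. a i \<le> b i)"
proof -
  have c: "Q \<in> carrier_mat n n" using Q by (simp add: inverse_pair_def)
  show ?thesis
  proof
    assume le: "cdiag n Q a \<le>\<^sub>L cdiag n Q b"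
    show "\<forall>i<n. a i \<le> b i"
    proof (intro allI impI)
      fix i assume "i < n"
      from cdiag_entry[OF Q this] obtain v where "v \<in> carrier_vec n"
        "(cdiag n Q (\<lambda>i. b i - a i) *\<^sub>v v) \<bullet>c v = complex_of_real (b i - a i)" by blast
      moreover have "pos_semidef (cdiag n Q (\<lambda>i. b i - a i))"
        using le by (simp add: loewner_le_def cdiag_diff[OF c])
      ultimately have "0 \<le> complex_of_real (b i - a i)"
        using carrier_matD(1)[OF cdiag_carrier[OF c]] by (metis pos_semidef_def)
      then show "a i \<le> b i" by (simp add: less_eq_complex_def)
    qed
  qed (use cdiag_le[OF c] in blast)
qed

lemma cdiag_eq_iff:
  assumes Q: "inverse_pair n Q R"
  shows "cdiag n Q a = cdiag n Q b \<longleftrightarrow> (\<forall>i<n. a i = b i)"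
proof
  assume eq: "cdiag n Q a = cdiag n Q b"
  \<comment> \<open>Reflexivity at \<open>a\<close>, rewritten along the equation, gives both
    inequalities; antisymmetry of the weights finishes.\<close>
  have "\<forall>i<n. a i \<le> a i" by simp
  then have "cdiag n Q a \<le>\<^sub>L cdiag n Q a" using cdiag_le_iff[OF Q] by blast
  with eq have "cdiag n Q a \<le>\<^sub>L cdiag n Q b" "cdiag n Q b \<le>\<^sub>L cdiag n Q a" by auto
  then show "\<forall>i<n. a i = b i" unfolding cdiag_le_iff[OF Q] by (meson order_antisym)
qed (auto intro: cdiag_cong)

section \<open>Functional calculus, simultaneous diagonalization and evaluation of means\<close>

lemma mat_fun_cdiag:
  "unitary n U \<Longrightarrow> mat_fun f (cdiag n U d) = cdiag n U (\<lambda>i. f (d i))"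
  unfolding cdiag_def by (rule mat_fun_spectral) auto

lemma unitary_one: "unitary n (1\<^sub>m n)"
  by (rule unitaryI) auto

lemma hermitian_cdiag:
  assumes "A \<in> carrier_mat n n" "hermitian A"
  obtains U d where "unitary n U" "A = cdiag n U d"
  using hermitian_spectral[OF assms] by (auto simp: cdiag_def)

lemma pos_def_cdiag:
  assumes "pos_def n A"
  obtains U d where "unitary n U" "A = cdiag n U d" "\<And>i. i < n \<Longrightarrow> d i > 0"
proof -
  from assms have "A \<in> carrier_mat n n" "hermitian A" by (auto simp: pos_def_def)
  then obtain U d where Ud: "unitary n U" "A = cdiag n U d" by (rule hermitian_cdiag)
  with assms cdiag_pos_def_iff[OF inverse_pair_unitary[OF Ud(1)]] that[OF Ud] show ?thesis by auto
qed

lemma mat_fun_hermitian: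
  assumes "A \<in> carrier_mat n n" "hermitian A"
  shows "mat_fun f A \<in> carrier_mat n n" "hermitian (mat_fun f A)"
proof -
  from assms obtain U d where "unitary n U" "A = cdiag n U d" by (rule hermitian_cdiag)
  then have "mat_fun f A = cdiag n U (\<lambda>i. f (d i))" "U \<in> carrier_mat n n"
    by (auto simp: mat_fun_cdiag unitary_def)
  then show "mat_fun f A \<in> carrier_mat n n" "hermitian (mat_fun f A)"
    by (auto simp: cdiag_carrier cdiag_hermitian)
qed

lemma mat_fun_compose:
  assumes "A \<in> carrier_mat n n" "hermitian A"
  shows "mat_fun f (mat_fun g A) = mat_fun (\<lambda>x. f (g x)) A"
proof -
  from assms obtain U d where "unitary n U" "A = cdiag n U d" by (rule hermitian_cdiag)
  then show ?thesis by (simp add: mat_fun_cdiag)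
qed

text \<open>Factor \<open>A\<close> as \<open>T * mat_adjoint T\<close> with inverse
  \<open>S\<close> of \<open>T\<close>, and diagonalize the Hermitian matrix
  \<open>S * B * mat_adjoint S\<close> by a unitary \<open>V\<close>. Passing from \<open>T\<close>
  to \<open>T * V\<close> preserves the factorization of \<open>A\<close> and makes \<open>B\<close>
  diagonal too.\<close>

lemma simultaneous_diagonalization:
  assumes A: "pos_def n A" and B: "B \<in> carrier_mat n n" "hermitian B"
  obtains Q R e where "inverse_pair n Q R" "A = cdiag n Q (\<lambda>_. 1)" "B = cdiag n Q e"
proof -
  from A obtain U d where U: "unitary n U" and A': "A = cdiag n U d" and d: "\<And>i. i < n \<Longrightarrow> d i > 0"
    by (rule pos_def_cdiag) blast
  define T where "T = U * real_diag n (\<lambda>i. sqrt (d i))"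
  define S where "S = real_diag n (\<lambda>i. 1 / sqrt (d i)) * mat_adjoint U"
  have TS: "inverse_pair n T S" unfolding T_def S_def
    using d by (intro inverse_pair_mult inverse_pair_unitary U inverse_pair_real_diag) (simp add: less_imp_neq[symmetric])
  have cU: "U \<in> carrier_mat n n" using U by (simp add: unitary_def)
  have c: "T \<in> carrier_mat n n" "S \<in> carrier_mat n n" and e: "T * S = 1\<^sub>m n"
    "mat_adjoint S * mat_adjoint T = 1\<^sub>m n"
    using TS inverse_pair_adjoint[OF TS] by (auto simp: inverse_pair_def)
  note c' = mat_adjoint_carrier[OF c(1)] mat_adjoint_carrier[OF c(2)]
  note assoc = square_mat[where n = n]
  define M where "M = S * B * mat_adjoint S"
  have M: "M \<in> carrier_mat n n" "hermitian M" using B c c'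
    by (auto simp: M_def hermitian_def mat_adjoint_mult[of _ n n _ n] assoc)
  from M obtain V f where V: "unitary n V" and M': "M = cdiag n V f" by (rule hermitian_cdiag)
  have cV: "V \<in> carrier_mat n n" using V by (simp add: unitary_def)
  have A1: "A = cdiag n T (\<lambda>_. 1)"
    unfolding T_def cdiag_real_diag[OF cU] A' by (rule cdiag_cong) (use d in \<open>simp add: less_imp_le\<close>)
  have V1: "cdiag n V (\<lambda>_. 1) = 1\<^sub>m n"
    using V right_mult_one_mat[OF cV] by (auto simp: cdiag_def real_diag_one unitary_def)
  show ?thesis
  proof
    show "inverse_pair n (T * V) (mat_adjoint V * S)"
      by (intro inverse_pair_mult TS inverse_pair_unitary V)
    show "A = cdiag n (T * V) (\<lambda>_. 1)"
      unfolding A1 cdiag_mult[OF c(1) cV] V1 by (simp add: cdiag_def real_diag_one)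
    have "T * M * mat_adjoint T = (T * S) * B * (mat_adjoint S * mat_adjoint T)"
      using B c c' by (simp add: M_def assoc)
    then show "B = cdiag n (T * V) f"
      using B by (simp add: cdiag_mult[OF c(1) cV] M'[symmetric] e)
  qed
qed

text \<open>The functional calculus acts on weights only through a unitary, whereas \<open>Q\<close>
  is only invertible. With \<open>H\<close> and \<open>G\<close> the square root of \<open>A\<close>
  and its inverse, the matrix \<open>W = G * T\<close> is unitary and diagonalizes
  \<open>G * B * G\<close>; multiplying by \<open>H\<close> on both sides returns to
  \<open>T\<close>.\<close>

theorem mean_of_cdiag:
  assumes Q: "inverse_pair n Q R" and a: "\<And>i. i < n \<Longrightarrow> a i > 0"
  shows "mean_of k (cdiag n Q a) (cdiag n Q b) = cdiag n Q (\<lambda>i. a i * k (b i / a i))"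
proof -
  define A where "A = cdiag n Q a"
  define B where "B = cdiag n Q b"
  note assoc = square_mat[where n = n]
  have cQ: "Q \<in> carrier_mat n n" using Q by (simp add: inverse_pair_def)
  from cdiag_pos_def[OF Q a] have "pos_def n A" by (simp add: A_def)
  then obtain U d where U: "unitary n U" and A: "A = cdiag n U d" and d: "\<And>i. i < n \<Longrightarrow> d i > 0"
    by (rule pos_def_cdiag) blast
  have cU: "U \<in> carrier_mat n n" "mat_adjoint U \<in> carrier_mat n n" and uU: "mat_adjoint U * U = 1\<^sub>m n"
    "U * mat_adjoint U = 1\<^sub>m n"
    using U by (auto simp: unitary_def mat_adjoint_carrier)
  define H where "H = cdiag n U (\<lambda>i. sqrt (d i))"
  define G where "G = cdiag n U (\<lambda>i. 1 / sqrt (d i))"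
  have HG: "inverse_pair n H G"
    using cdiag_inverse[OF inverse_pair_unitary[OF U], of "\<lambda>i. sqrt (d i)"] d
    by (simp add: H_def G_def less_imp_neq[symmetric])
  have h: "mat_adjoint H = H" "mat_adjoint G = G"
    using cdiag_hermitian[OF cU(1)] by (auto simp: H_def G_def hermitian_def)
  have c: "H \<in> carrier_mat n n" "G \<in> carrier_mat n n" and HG1: "H * G = 1\<^sub>m n" "G * H = 1\<^sub>m n"
    using HG by (auto simp: inverse_pair_def)
  have HH: "H * H = A"
  proof -
    define s where "s i = sqrt (d i)" for i
    have "H * H = U * real_diag n s * (mat_adjoint U * U) * real_diag n s * mat_adjoint U"
      using cU by (simp add: H_def cdiag_def assoc flip: s_def)
    also have "\<dots> = cdiag n U (\<lambda>i. s i * s i)"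
      using cU by (simp add: uU left_mult_one_mat[of _ n n] cdiag_def assoc flip: real_diag_mult)
    also have "\<dots> = A" unfolding A by (rule cdiag_cong) (use d in \<open>simp add: s_def less_imp_le\<close>)
    finally show ?thesis .
  qed
  \<comment> \<open>\<open>T\<close> absorbs the weights of \<open>A\<close>, so that
    \<open>T * mat_adjoint T\<close> is \<open>A\<close> and \<open>B\<close> has weights
    \<open>b i / a i\<close> with respect to \<open>T\<close>.\<close>
  define T where "T = Q * real_diag n (\<lambda>i. sqrt (a i))"
  have cT: "T \<in> carrier_mat n n" using cQ by (simp add: T_def)
  have T: "cdiag n T e = cdiag n Q (\<lambda>i. a i * e i)" for e
    unfolding T_def cdiag_real_diag[OF cQ] by (rule cdiag_cong) (use a in \<open>simp add: less_imp_le\<close>)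
  \<comment> \<open>The unitary factor in the polar decomposition \<open>T = H * W\<close>.\<close>
  define W where "W = G * T"
  have cW: "W \<in> carrier_mat n n" using c cT by (simp add: W_def)
  have "W * mat_adjoint W = cdiag n W (\<lambda>_. 1)" using cW by (simp add: cdiag_def real_diag_one)
  also have "\<dots> = G * A * G" by (simp add: W_def cdiag_mult[OF c(2) cT] T h A_def)
  also have "\<dots> = (G * H) * (H * G)" using c by (simp add: assoc flip: HH)
  finally have "W * mat_adjoint W = 1\<^sub>m n" by (simp add: HG1)
  then have uW: "unitary n W"
    using mat_mult_left_right_inverse[OF cW mat_adjoint_carrier[OF cW]] cW by (auto intro: unitaryI)
  have HW: "H * W = T"
  proof -
    have "H * W = (H * G) * T" using c cT by (simp add: W_def assoc)
    then show ?thesis using cT by (simp add: HG1)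
  qed
  have "B = cdiag n T (\<lambda>i. b i / a i)"
    unfolding T B_def by (rule cdiag_cong) (use a in \<open>simp add: less_imp_neq[symmetric]\<close>)
  then have "G * B * G = cdiag n W (\<lambda>i. b i / a i)"
    by (simp add: W_def cdiag_mult[OF c(2) cT] h)
  then have "mean_of k A B = H * cdiag n W (\<lambda>i. k (b i / a i)) * H"
    unfolding mean_of_def using A U uW by (simp add: mat_fun_cdiag flip: H_def G_def)
  also have "\<dots> = cdiag n T (\<lambda>i. k (b i / a i))"
    using cdiag_mult[OF c(1) cW] by (simp add: h HW)
  also have "\<dots> = cdiag n Q (\<lambda>i. a i * k (b i / a i))" by (rule T)
  finally show ?thesis by (simp add: A_def B_def)
qed

section \<open>Means and representing functions\<close>

text \<open>The scalar counterpart of \<open>symmetric_mean\<close>: exchanging the arguments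
  replaces \<open>k\<close> by its transpose \<open>t * k (1 / t)\<close>.\<close>

definition symmetric_fun :: "(real \<Rightarrow> real) \<Rightarrow> bool" where
  "symmetric_fun k \<longleftrightarrow> (\<forall>t>0. t * k (1 / t) = k t)"

lemma pos_def_pair:
  assumes "pos_def n A" "pos_def n B"
  obtains Q R e where "inverse_pair n Q R" "A = cdiag n Q (\<lambda>_. 1)" "B = cdiag n Q e" "\<And>i. i < n \<Longrightarrow> e i > 0"
proof -
  have "B \<in> carrier_mat n n" "hermitian B" using assms(2) by (auto simp: pos_def_def)
  with assms(1) obtain Q R e where Q: "inverse_pair n Q R" "A = cdiag n Q (\<lambda>_. 1)" "B = cdiag n Q e"
    by (rule simultaneous_diagonalization)
  with assms(2) cdiag_pos_def_iff[OF Q(1)] that show ?thesis by blast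
qed

lemma mean_of_pos_def:
  assumes "pos_def n A" "pos_def n B" "\<And>t. t > 0 \<Longrightarrow> k t > 0"
  shows "pos_def n (mean_of k A B)"
proof -
  from assms(1,2) obtain Q R e where Q: "inverse_pair n Q R" "A = cdiag n Q (\<lambda>_. 1)" "B = cdiag n Q e"
    and e: "\<And>i. i < n \<Longrightarrow> e i > 0" by (rule pos_def_pair) blast
  then show ?thesis using assms(3) by (simp add: mean_of_cdiag[OF Q(1)] cdiag_pos_def_iff[OF Q(1)])
qed

text \<open>For common weights \<open>1\<close> and \<open>e i\<close> the two orders of the
  arguments yield \<open>k (e i)\<close> and \<open>e i * k (1 / e i)\<close>.\<close>

lemma mean_of_symmetric:
  assumes "pos_def n A" "pos_def n B" "symmetric_fun k"
  shows "mean_of k A B = mean_of k B A"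
proof -
  from assms(1,2) obtain Q R e where Q: "inverse_pair n Q R" "A = cdiag n Q (\<lambda>_. 1)" "B = cdiag n Q e"
    and e: "\<And>i. i < n \<Longrightarrow> e i > 0" by (rule pos_def_pair) blast
  then show ?thesis using assms(3)
    by (simp add: mean_of_cdiag[OF Q(1)] symmetric_fun_def cdiag_eq_iff[OF Q(1)])
qed

lemma mean_of_mono:
  assumes "pos_def n A" "pos_def n B" "\<And>t. t > 0 \<Longrightarrow> k t \<le> l t"
  shows "mean_of k A B \<le>\<^sub>L mean_of l A B"
proof -
  from assms(1,2) obtain Q R e where Q: "inverse_pair n Q R" "A = cdiag n Q (\<lambda>_. 1)" "B = cdiag n Q e"
    and e: "\<And>i. i < n \<Longrightarrow> e i > 0" by (rule pos_def_pair) blast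
  then show ?thesis using assms(3) by (simp add: mean_of_cdiag[OF Q(1)] cdiag_le_iff[OF Q(1)])
qed

text \<open>Matrices of size one, as \<open>cdiag 1 (1\<^sub>m 1) (\<lambda>_. x)\<close>, recover the properties of the
  representing function from those of the mean.\<close>

lemma representing_le:
  assumes "\<And>n A B. pos_def n A \<Longrightarrow> pos_def n B \<Longrightarrow> mean_of k A B \<le>\<^sub>L mean_of l A B" "t > 0"
  shows "k t \<le> l t"
  using assms(1)[of 1 "cdiag 1 (1\<^sub>m 1) (\<lambda>_. 1)" "cdiag 1 (1\<^sub>m 1) (\<lambda>_. t)"] assms(2)
  by (simp add: cdiag_pos_def_iff[OF inverse_pair_one] mean_of_cdiag[OF inverse_pair_one]
      cdiag_le_iff[OF inverse_pair_one] del: One_nat_def)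

lemma representing_symmetric:
  assumes "\<And>n A B. pos_def n A \<Longrightarrow> pos_def n B \<Longrightarrow> mean_of k A B = mean_of k B A"
  shows "symmetric_fun k"
  unfolding symmetric_fun_def
proof (intro allI impI)
  fix t :: real assume "t > 0"
  then show "t * k (1 / t) = k t"
    using assms[of 1 "cdiag 1 (1\<^sub>m 1) (\<lambda>_. 1)" "cdiag 1 (1\<^sub>m 1) (\<lambda>_. t)"]
    by (simp add: cdiag_pos_def_iff[OF inverse_pair_one] mean_of_cdiag[OF inverse_pair_one]
        cdiag_eq_iff[OF inverse_pair_one] del: One_nat_def)
qed

lemma operator_monotone_mono:
  assumes "operator_monotone k" "0 < s" "s \<le> t"
  shows "k s \<le> k t"
proof -
  have "pos_def 1 (cdiag 1 (1\<^sub>m 1) (\<lambda>_. s))" "pos_def 1 (cdiag 1 (1\<^sub>m 1) (\<lambda>_. t))"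
    "cdiag 1 (1\<^sub>m 1) (\<lambda>_. s) \<le>\<^sub>L cdiag 1 (1\<^sub>m 1) (\<lambda>_. t)"
    using assms(2,3) by (simp_all add: cdiag_pos_def_iff[OF inverse_pair_one]
        cdiag_le_iff[OF inverse_pair_one] del: One_nat_def)
  then have "mat_fun k (cdiag 1 (1\<^sub>m 1) (\<lambda>_. s)) \<le>\<^sub>L mat_fun k (cdiag 1 (1\<^sub>m 1) (\<lambda>_. t))"
    using assms(1) unfolding operator_monotone_def by blast
  then show ?thesis
    by (simp add: mat_fun_cdiag[OF unitary_one] cdiag_le_iff[OF inverse_pair_one] del: One_nat_def)
qed

text \<open>Symmetry turns monotonicity of \<open>k\<close> into antitonicity of \<open>k t / t = k (1 / t)\<close>, and the two
  together squeeze \<open>k\<close> near each point.\<close>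

lemma symmetric_monotone_continuous:
  assumes mono: "\<And>s t. 0 < s \<Longrightarrow> s \<le> t \<Longrightarrow> k s \<le> k t" and sym: "symmetric_fun k"
  shows "continuous_on {0<..} k"
proof (rule continuous_at_imp_continuous_on, rule ballI)
  fix x :: real assume "x \<in> {0<..}"
  then have x: "x > 0" by simp
  have lip: "k t \<le> t / s * k s" if "0 < s" "s \<le> t" for s t
  proof -
    have "k t = t * k (1 / t)" "k s = s * k (1 / s)" using sym that by (simp_all add: symmetric_fun_def)
    moreover have "t * k (1 / t) \<le> t * k (1 / s)"
      using that by (intro mult_left_mono mono) (auto simp: field_simps)
    ultimately show ?thesis using that by simp
  qed
  \<comment> \<open>Taking \<open>min\<close> and \<open>max\<close> covers points on both sides of
    \<open>x\<close> with one pair of bounds, each tending to \<open>k x\<close>.\<close>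
  have b: "min (k x) (t / x * k x) \<le> k t \<and> k t \<le> max (k x) (t / x * k x)" if "t > 0" for t
  proof (cases "t \<le> x")
    case True
    have "k t \<le> k x" "t / x * k x \<le> k t"
      using mono[of t x] lip[of t x] True that x by (simp_all add: field_simps)
    then show ?thesis by (simp only: min.coboundedI2 max.coboundedI1 simp_thms)
  next
    case False
    have "k x \<le> k t" "k t \<le> t / x * k x"
      using mono[of x t] lip[of x t] False x by simp_all
    then show ?thesis by (simp only: min.coboundedI1 max.coboundedI2 simp_thms)
  qed
  have ev: "eventually (\<lambda>t. t > 0) (at x)"
    by (rule order_tendstoD(1)[OF tendsto_ident_at x])
  have l: "((\<lambda>t. min (k x) (t / x * k x)) \<longlongrightarrow> min (k x) (x / x * k x)) (at x)"
    and u: "((\<lambda>t. max (k x) (t / x * k x)) \<longlongrightarrow> max (k x) (x / x * k x)) (at x)"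
    by (intro tendsto_intros, use x in simp)+
  have "(k \<longlongrightarrow> k x) (at x)"
  proof (rule tendsto_sandwich)
    show "eventually (\<lambda>t. min (k x) (t / x * k x) \<le> k t) (at x)"
      "eventually (\<lambda>t. k t \<le> max (k x) (t / x * k x)) (at x)"
      by (rule eventually_mono[OF ev], use b in blast)+
  qed (use l u x in auto)
  then show "isCont k x" by (simp add: isCont_def)
qed

text \<open>Operator monotonicity at size one gives scalar monotonicity; together with symmetry this
  yields the continuity needed for the intermediate value argument.\<close>

lemma operator_mean_cases:
  assumes "operator_mean \<sigma>" "symmetric_mean \<sigma>"
  obtains k where "\<And>n A B. pos_def n A \<Longrightarrow> pos_def n B \<Longrightarrow> \<sigma> A B = mean_of k A B"
    "symmetric_fun k" "continuous_on {0<..} k" "k 1 = 1" "\<And>t. t > 0 \<Longrightarrow> k t > 0"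
proof -
  from assms(1) obtain k where k: "operator_monotone k" "\<forall>t>0. k t > 0" "k 1 = 1"
    and \<sigma>: "\<And>n A B. pos_def n A \<Longrightarrow> pos_def n B \<Longrightarrow> \<sigma> A B = mean_of k A B"
    unfolding operator_mean_def by blast
  have "mean_of k A B = mean_of k B A" if "pos_def n A" "pos_def n B" for n A B
    using \<sigma>[OF that] \<sigma>[OF that(2,1)] assms(2) that unfolding symmetric_mean_def by metis
  then have sym: "symmetric_fun k" by (rule representing_symmetric)
  with operator_monotone_mono[OF k(1)] have "continuous_on {0<..} k"
    by (rule symmetric_monotone_continuous)
  with k \<sigma> sym that show ?thesis by blast
qed

lemma mean_of_neq:
  assumes "pos_def n A" "pos_def n B" "mean_of k A B \<noteq> mean_of l A B"
  obtains t where "t > 0" "k t \<noteq> l t"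
proof -
  from assms(1,2) obtain Q R e where Q: "inverse_pair n Q R" "A = cdiag n Q (\<lambda>_. 1)" "B = cdiag n Q e"
    and e: "\<And>i. i < n \<Longrightarrow> e i > 0" by (rule pos_def_pair) blast
  with assms(3) that show ?thesis by (auto simp: mean_of_cdiag[OF Q(1)] cdiag_eq_iff[OF Q(1)])
qed

section \<open>From bounded ratios to full operator monotonicity\<close>

lemma loewner_trans:
  assumes le: "A \<le>\<^sub>L B" "B \<le>\<^sub>L C"
    and c: "A \<in> carrier_mat n n" "B \<in> carrier_mat n n" "C \<in> carrier_mat n n"
  shows "A \<le>\<^sub>L C"
proof -
  have h: "hermitian A" "hermitian C" and ps: "pos_semidef (B - A)" "pos_semidef (C - B)"
    using le by (simp_all add: loewner_le_def)
  have dc: "B - A \<in> carrier_mat n n" "C - B \<in> carrier_mat n n" "C - A \<in> carrier_mat n n"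
    using c by (simp_all add: minus_carrier_mat)
  have d: "C - A = (C - B) + (B - A)" using c by (intro eq_matI) auto
  have "0 \<le> ((C - A) *\<^sub>v v) \<bullet>c v" if v: "v \<in> carrier_vec n" for v
  proof -
    note mc = mult_mat_vec_carrier[OF dc(1) v] mult_mat_vec_carrier[OF dc(2) v]
    have cv: "conjugate v \<in> carrier_vec n" using v by simp
    have "((C - A) *\<^sub>v v) \<bullet>c v = ((C - B) *\<^sub>v v) \<bullet>c v + ((B - A) *\<^sub>v v) \<bullet>c v"
      unfolding d add_mult_distrib_mat_vec[OF dc(2,1) v] by (rule add_scalar_prod_distrib[OF mc(2,1) cv])
    moreover have "0 \<le> ((C - B) *\<^sub>v v) \<bullet>c v" "0 \<le> ((B - A) *\<^sub>v v) \<bullet>c v"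
      using ps v carrier_matD(1)[OF dc(1)] carrier_matD(1)[OF dc(2)] unfolding pos_semidef_def by metis+
    ultimately show ?thesis by simp
  qed
  moreover have "hermitian (C - A)"
    using h unfolding hermitian_def mat_adjoint_minus[OF c(3,1)] by simp
  ultimately have "pos_semidef (C - A)" using carrier_matD(1)[OF dc(3)] by (simp add: pos_semidef_def)
  then show ?thesis using h c by (simp add: loewner_le_def)
qed

lemma loewner_refl: "A \<in> carrier_mat n n \<Longrightarrow> hermitian A \<Longrightarrow> A \<le>\<^sub>L A"
  by (auto simp: loewner_le_def pos_semidef_def hermitian_def mat_adjoint_minus[of _ n n]
      minus_r_inv_mat scalar_prod_def)

text \<open>Larger gaps are bridged in finitely many steps from \<open>a\<close> to \<open>min b (r * a)\<close>.\<close>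

lemma operator_monotone_local:
  assumes r: "r > 1"
    and step: "\<And>n Q R a b. inverse_pair n Q R \<Longrightarrow> (\<And>i. i < n \<Longrightarrow> a i > 0 \<and> a i \<le> b i \<and> b i \<le> r * a i) \<Longrightarrow>
      mat_fun f (cdiag n Q a) \<le>\<^sub>L mat_fun f (cdiag n Q b)"
  shows "operator_monotone f"
  unfolding operator_monotone_def
proof (intro allI impI)
  fix n X Y assume X: "pos_def n X" and Y: "pos_def n Y" and le: "X \<le>\<^sub>L Y"
  from X Y obtain Q R e where Q: "inverse_pair n Q R" and XY: "X = cdiag n Q (\<lambda>_. 1)" "Y = cdiag n Q e"
    by (rule pos_def_pair)
  have e: "e i \<ge> 1" if "i < n" for i using le that by (simp add: XY cdiag_le_iff[OF Q])
  have cQ: "Q \<in> carrier_mat n n" using Q by (simp add: inverse_pair_def)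
  have c: "mat_fun f (cdiag n Q a) \<in> carrier_mat n n" "hermitian (mat_fun f (cdiag n Q a))" for a
    by (intro mat_fun_hermitian[of _ n] cdiag_carrier cdiag_hermitian cQ)+
  \<comment> \<open>The exponent \<open>m\<close> counts the steps; each one uses up a factor
    \<open>r\<close> of the allowed ratio.\<close>
  have chain: "mat_fun f (cdiag n Q a) \<le>\<^sub>L mat_fun f (cdiag n Q b)"
    if "\<And>i. i < n \<Longrightarrow> a i > 0 \<and> a i \<le> b i \<and> b i \<le> r ^ m * a i" for m a b
    using that
  proof (induction m arbitrary: a)
    case 0
    then have "cdiag n Q a = cdiag n Q b" by (intro cdiag_cong) force
    then show ?case using c[of b] loewner_refl by simp
  next
    case (Suc m)
    define c' where "c' i = min (b i) (r * a i)" for i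
    have le1: "a i > 0 \<and> a i \<le> c' i \<and> c' i \<le> r * a i" if "i < n" for i
      using Suc.prems[OF that] r by (auto simp: c'_def)
    \<comment> \<open>Where the cap \<open>b i\<close> is reached, the last bound is
      \<open>b i \<le> r ^ m * b i\<close>, which needs \<open>1 \<le> r ^ m\<close>; elsewhere one
      factor \<open>r\<close> is removed from the bound.\<close>
    have "c' i > 0 \<and> c' i \<le> b i \<and> b i \<le> r ^ m * c' i" if "i < n" for i
      using Suc.prems[OF that] le1[OF that] r
        mult_right_mono[of 1 "r ^ m" "b i"] by (auto simp: c'_def min_def mult_ac)
    then have "mat_fun f (cdiag n Q c') \<le>\<^sub>L mat_fun f (cdiag n Q b)" by (rule Suc.IH)
    moreover have "mat_fun f (cdiag n Q a) \<le>\<^sub>L mat_fun f (cdiag n Q c')"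
      using Q le1 by (rule step)
    \<comment> \<open>Transitivity for arbitrary matrices is called for: the values of
      \<open>mat_fun f\<close> need not be congruences by a common \<open>Q\<close>.\<close>
    ultimately show ?case using loewner_trans c by blast
  qed
  \<comment> \<open>The sum dominates every \<open>e i\<close>, so a single exponent serves all
    indices, also when \<open>n = 0\<close>.\<close>
  obtain m where m: "(\<Sum>i<n. e i) < r ^ m" using real_arch_pow[OF r] by blast
  have "e i \<le> r ^ m" if "i < n" for i
  proof -
    have "e i \<le> (\<Sum>i<n. e i)"
      by (rule member_le_sum) (use e that in \<open>simp_all add: order_trans[OF zero_le_one]\<close>)
    with m show ?thesis by simp
  qed
  then show "mat_fun f X \<le>\<^sub>L mat_fun f Y"
    unfolding XY by (intro chain[of _ _ m]) (use e in auto)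
qed

text \<open>For commuting \<open>A\<close> and \<open>B\<close> with quotient \<open>x\<^sup>2\<close> and geometric mean \<open>c\<close>, the mean with
  representing function \<open>k\<close> is \<open>c * (x * k (1 / x\<^sup>2))\<close>; the second factor runs through an interval.\<close>

lemma realize_means:
  assumes k: "continuous_on {0<..} k" "k 1 = 1" and t: "t > 0"
    and Q: "inverse_pair n Q R"
    and c: "\<And>i. i < n \<Longrightarrow> c i > 0"
    and e: "\<And>i. i < n \<Longrightarrow> min 1 (k t / sqrt t) * c i \<le> e i \<and> e i \<le> max 1 (k t / sqrt t) * c i"
  obtains A B where "pos_def n A" "pos_def n B" "mean_of sqrt A B = cdiag n Q c" "mean_of k A B = cdiag n Q e"
proof -
  define g where "g x = x * k (1 / x\<^sup>2)" for x
  let ?v = "k t / sqrt t"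
  have "continuous_on {0<..} g"
    unfolding g_def by (intro continuous_intros continuous_on_compose2[OF k(1)]) auto
  then have conn: "connected (g ` {0<..})" by (rule connected_continuous_image) (rule connected_Ioi)
  \<comment> \<open>The point \<open>x = 1 / sqrt t\<close> is chosen so that
    \<open>1 / x\<^sup>2\<close> is \<open>t\<close>; it provides the second endpoint.\<close>
  have "g 1 = 1" "g (1 / sqrt t) = ?v"
    using k(2) t by (simp_all add: g_def power_divide)
  then have "1 \<in> g ` {0<..}" "?v \<in> g ` {0<..}"
    using t image_eqI[of 1 g 1 "{0<..}"] image_eqI[of ?v g "1 / sqrt t" "{0<..}"] by simp_all
  then have im: "min 1 ?v \<in> g ` {0<..}" "max 1 ?v \<in> g ` {0<..}"
    by (simp_all add: min_def max_def)
  have "\<exists>x>0. g x = e i / c i" if "i < n" for i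
  proof -
    have "min 1 ?v \<le> e i / c i" "e i / c i \<le> max 1 ?v"
      using c[OF that] e[OF that] by (simp_all only: pos_le_divide_eq pos_divide_le_eq)
    then have "e i / c i \<in> g ` {0<..}" by (rule connectedD_interval[OF conn im])
    then show ?thesis by force
  qed
  then obtain x where x: "\<And>i. i < n \<Longrightarrow> x i > 0 \<and> g (x i) = e i / c i" by metis
  have p: "c i * x i > 0" "c i / x i > 0" if "i < n" for i
    using c[OF that] x[OF that] by simp_all
  \<comment> \<open>A general \<open>l\<close> allows one computation for both means; the weights of
    the pair have quotient \<open>1 / (x i)\<^sup>2\<close>.\<close>
  have mean: "mean_of l (cdiag n Q (\<lambda>i. c i * x i)) (cdiag n Q (\<lambda>i. c i / x i)) =
      cdiag n Q (\<lambda>i. c i * (x i * l (1 / (x i)\<^sup>2)))" for l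
  proof -
    have "mean_of l (cdiag n Q (\<lambda>i. c i * x i)) (cdiag n Q (\<lambda>i. c i / x i)) =
        cdiag n Q (\<lambda>i. c i * x i * l (c i / x i / (c i * x i)))"
      by (rule mean_of_cdiag[OF Q p(1)])
    also have "\<dots> = cdiag n Q (\<lambda>i. c i * (x i * l (1 / (x i)\<^sup>2)))"
    proof (rule cdiag_cong)
      fix i assume "i < n"
      then have "c i / x i / (c i * x i) = 1 / (x i)\<^sup>2"
        using c[of i] by (simp add: power2_eq_square)
      then show "c i * x i * l (c i / x i / (c i * x i)) = c i * (x i * l (1 / (x i)\<^sup>2))"
        by (simp only: mult.assoc)
    qed
    finally show ?thesis .
  qed
  show ?thesis
  proof
    show "pos_def n (cdiag n Q (\<lambda>i. c i * x i))" "pos_def n (cdiag n Q (\<lambda>i. c i / x i))"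
      unfolding cdiag_pos_def_iff[OF Q] using p by blast+
    show "mean_of sqrt (cdiag n Q (\<lambda>i. c i * x i)) (cdiag n Q (\<lambda>i. c i / x i)) = cdiag n Q c"
      unfolding mean
    proof (rule cdiag_cong)
      fix i assume "i < n"
      then show "c i * (x i * sqrt (1 / (x i)\<^sup>2)) = c i" using x[of i] by (simp add: real_sqrt_divide)
    qed
    show "mean_of k (cdiag n Q (\<lambda>i. c i * x i)) (cdiag n Q (\<lambda>i. c i / x i)) = cdiag n Q e"
      unfolding mean
    proof (rule cdiag_cong)
      fix i assume i: "i < n"
      show "c i * (x i * k (1 / (x i)\<^sup>2)) = e i"
        using x[OF i] c[OF i] by (simp flip: g_def)
    qed
  qed
qed

section \<open>Comparison of means forces operator monotonicity\<close>

lemma mean_less_representing: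
  assumes less: "mean_less \<sigma> \<tau>"
    and \<sigma>: "\<And>n A B. pos_def n A \<Longrightarrow> pos_def n B \<Longrightarrow> \<sigma> A B = mean_of k A B"
    and \<tau>: "\<And>n A B. pos_def n A \<Longrightarrow> pos_def n B \<Longrightarrow> \<tau> A B = mean_of l A B"
  obtains t where "t > 0" "k t < l t"
proof -
  from less have le: "\<sigma> A B \<le>\<^sub>L \<tau> A B" if "pos_def n A" "pos_def n B" for n A B
    using that unfolding mean_less_def by blast
  from less obtain n A B where AB: "pos_def n A" "pos_def n B" and "\<sigma> A B \<noteq> \<tau> A B"
    unfolding mean_less_def by blast
  then have "mean_of k A B \<noteq> mean_of l A B" using \<sigma>[OF AB] \<tau>[OF AB] by simp
  with AB obtain t where t: "t > 0" "k t \<noteq> l t" by (rule mean_of_neq)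
  have "mean_of k A B \<le>\<^sub>L mean_of l A B" if "pos_def n A" "pos_def n B" for n A B
    using le[OF that] \<sigma>[OF that] \<tau>[OF that] by simp
  \<comment> \<open>Since the values already differ at \<open>t\<close>, the order of the means
    makes the inequality strict there.\<close>
  then have "k t \<le> l t" using t(1) by (rule representing_le)
  with t that show ?thesis by simp
qed

text \<open>At a point of strict inequality the ratio \<open>k t / sqrt t\<close> exceeds
  \<open>1\<close>. Weights \<open>a\<close> and \<open>b\<close> within this ratio are realized as
  the geometric mean and the \<open>\<sigma>\<close>-mean of one pair, so the hypothesis on
  \<open>f\<close> is exactly the local step.\<close>

lemma operator_monotone_if_greater_mean:
  assumes \<sigma>: "operator_mean \<sigma>" "symmetric_mean \<sigma>" "mean_less (\<sharp>) \<sigma>"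
    and f: "\<And>n A B. pos_def n A \<Longrightarrow> pos_def n B \<Longrightarrow> mat_fun f (A \<sharp> B) \<le>\<^sub>L mat_fun f (\<sigma> A B)"
  shows "operator_monotone f"
proof -
  from \<sigma>(1,2) obtain k where k: "\<And>n A B. pos_def n A \<Longrightarrow> pos_def n B \<Longrightarrow> \<sigma> A B = mean_of k A B"
    "continuous_on {0<..} k" "k 1 = 1"
    by (rule operator_mean_cases) blast
  obtain t where t: "t > 0" "sqrt t < k t"
    by (rule mean_less_representing[OF \<sigma>(3) geometric_mean_def k(1)])
  then have r: "k t / sqrt t > 1" by simp
  then have mm: "min 1 (k t / sqrt t) = 1" "max 1 (k t / sqrt t) = k t / sqrt t" by linarith+
  from r show ?thesis
  proof (rule operator_monotone_local)
    fix n Q R and a b :: "nat \<Rightarrow> real"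
    assume Q: "inverse_pair n Q R" and ab: "\<And>i. i < n \<Longrightarrow> a i > 0 \<and> a i \<le> b i \<and> b i \<le> k t / sqrt t * a i"
    obtain A B where AB: "pos_def n A" "pos_def n B" "mean_of sqrt A B = cdiag n Q a" "mean_of k A B = cdiag n Q b"
      by (rule realize_means[OF k(2,3) t(1) Q, of a b, unfolded mm mult_1]) (use ab in blast)+
    with f[OF AB(1,2)] k(1)[OF AB(1,2)]
    show "mat_fun f (cdiag n Q a) \<le>\<^sub>L mat_fun f (cdiag n Q b)" by (simp only: geometric_mean_def)
  qed
qed

text \<open>The roles are exchanged: the larger weights \<open>b\<close> now come from the geometric
  mean and \<open>a\<close> from the \<open>\<sigma>\<close>-mean, with allowed ratio
  \<open>sqrt t / k t\<close>.\<close>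

lemma operator_monotone_if_less_mean:
  assumes \<sigma>: "operator_mean \<sigma>" "symmetric_mean \<sigma>" "mean_less \<sigma> (\<sharp>)"
    and f: "\<And>n A B. pos_def n A \<Longrightarrow> pos_def n B \<Longrightarrow> mat_fun f (\<sigma> A B) \<le>\<^sub>L mat_fun f (A \<sharp> B)"
  shows "operator_monotone f"
proof -
  from \<sigma>(1,2) obtain k where k: "\<And>n A B. pos_def n A \<Longrightarrow> pos_def n B \<Longrightarrow> \<sigma> A B = mean_of k A B"
    "continuous_on {0<..} k" "k 1 = 1" "\<And>t. t > 0 \<Longrightarrow> k t > 0"
    by (rule operator_mean_cases) blast
  obtain t where t: "t > 0" "k t < sqrt t"
    by (rule mean_less_representing[OF \<sigma>(3) k(1) geometric_mean_def])
  have pos: "k t > 0" "sqrt t > 0" using k(4) t(1) by simp_all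
  have "k t / sqrt t < 1" using t by simp
  then have mm: "min 1 (k t / sqrt t) = k t / sqrt t" "max 1 (k t / sqrt t) = 1" by linarith+
  have "sqrt t / k t > 1" using t pos by simp
  then show ?thesis
  proof (rule operator_monotone_local)
    fix n Q R and a b :: "nat \<Rightarrow> real"
    assume Q: "inverse_pair n Q R" and ab: "\<And>i. i < n \<Longrightarrow> a i > 0 \<and> a i \<le> b i \<and> b i \<le> sqrt t / k t * a i"
    have b: "b i > 0" if "i < n" for i using ab[OF that] by linarith
    \<comment> \<open>This restates the ratio bound relative to \<open>b\<close>, the form required
      by \<open>realize_means\<close> when \<open>b\<close> is the geometric mean.\<close>
    have bnd: "k t / sqrt t * b i \<le> a i \<and> a i \<le> b i" if "i < n" for i
    proof -
      have "k t / sqrt t * b i \<le> k t / sqrt t * (sqrt t / k t * a i)"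
        using ab[OF that] pos by (intro mult_left_mono) simp_all
      then show ?thesis using ab[OF that] pos by simp
    qed
    obtain A B where AB: "pos_def n A" "pos_def n B" "mean_of sqrt A B = cdiag n Q b" "mean_of k A B = cdiag n Q a"
      by (rule realize_means[OF k(2,3) t(1) Q, of b a, unfolded mm mult_1]) (use bnd b in blast)+
    with f[OF AB(1,2)] k(1)[OF AB(1,2)]
    show "mat_fun f (cdiag n Q a) \<le>\<^sub>L mat_fun f (cdiag n Q b)" by (simp only: geometric_mean_def)
  qed
qed

section \<open>The arithmetic and harmonic means as witnesses\<close>

lemma mat_fun_affine:
  assumes "A \<in> carrier_mat n n" "hermitian A"
  shows "mat_fun (\<lambda>x. a + b * x) A = of_real a \<cdot>\<^sub>m 1\<^sub>m n + of_real b \<cdot>\<^sub>m A"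
proof -
  from assms obtain U d where U: "unitary n U" and A: "A = cdiag n U d" by (rule hermitian_cdiag)
  have c: "U \<in> carrier_mat n n" using U by (simp add: unitary_def)
  have "cdiag n U (\<lambda>_. 1) = 1\<^sub>m n"
    using U right_mult_one_mat[OF c] by (auto simp: cdiag_def real_diag_one unitary_def)
  then show ?thesis
    using cdiag_affine[OF c, of a "\<lambda>_. 1" b d] by (simp add: A mat_fun_cdiag[OF U])
qed

lemma pos_semidef_smult:
  assumes M: "pos_semidef M" "M \<in> carrier_mat n n" and b: "b \<ge> 0"
  shows "pos_semidef (of_real b \<cdot>\<^sub>m M)"
proof -
  have "0 \<le> ((of_real b \<cdot>\<^sub>m M) *\<^sub>v v) \<bullet>c v" if v: "v \<in> carrier_vec n" for v
  proof -
    have "(of_real b \<cdot>\<^sub>m M) *\<^sub>v v = of_real b \<cdot>\<^sub>v (M *\<^sub>v v)"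
      using M v by (intro eq_vecI) (auto simp: scalar_prod_def sum_distrib_left mult_ac)
    then have "((of_real b \<cdot>\<^sub>m M) *\<^sub>v v) \<bullet>c v = of_real b * ((M *\<^sub>v v) \<bullet>c v)"
      using M v by simp
    moreover have "0 \<le> (M *\<^sub>v v) \<bullet>c v" using M v by (auto simp: pos_semidef_def)
    ultimately show ?thesis using b by (simp add: less_eq_complex_def)
  qed
  then show ?thesis using M by (auto simp: pos_semidef_def hermitian_def mat_adjoint_smult_real)
qed

text \<open>The values at \<open>Y\<close> and \<open>X\<close> differ by \<open>b\<close> times
  \<open>Y - X\<close>. The decreasing case enters the treatment of the harmonic mean.\<close>

lemma mat_fun_affine_mono:
  assumes le: "X \<le>\<^sub>L Y" and c: "X \<in> carrier_mat n n" "Y \<in> carrier_mat n n"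
  shows "b \<ge> 0 \<Longrightarrow> mat_fun (\<lambda>x. a + b * x) X \<le>\<^sub>L mat_fun (\<lambda>x. a + b * x) Y"
    and "b \<le> 0 \<Longrightarrow> mat_fun (\<lambda>x. a + b * x) Y \<le>\<^sub>L mat_fun (\<lambda>x. a + b * x) X"
proof -
  let ?X = "mat_fun (\<lambda>x. a + b * x) X" and ?Y = "mat_fun (\<lambda>x. a + b * x) Y"
  have h: "hermitian X" "hermitian Y" using le by (auto simp: loewner_le_def)
  have d: "pos_semidef (Y - X)" "Y - X \<in> carrier_mat n n" using le c by (auto simp: loewner_le_def)
  note H = mat_fun_hermitian[OF c(1) h(1), of "\<lambda>x. a + b * x"] mat_fun_hermitian[OF c(2) h(2), of "\<lambda>x. a + b * x"]
  have "?Y - ?X = of_real b \<cdot>\<^sub>m (Y - X)" "?X - ?Y = of_real (- b) \<cdot>\<^sub>m (Y - X)"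
    unfolding mat_fun_affine[OF c(1) h(1)] mat_fun_affine[OF c(2) h(2)]
    using c by (intro eq_matI; simp add: algebra_simps)+
  then show "b \<ge> 0 \<Longrightarrow> ?X \<le>\<^sub>L ?Y" "b \<le> 0 \<Longrightarrow> ?Y \<le>\<^sub>L ?X"
    using H pos_semidef_smult[OF d, of b] pos_semidef_smult[OF d, of "- b"] by (simp_all add: loewner_le_def)
qed

text \<open>Identifies the functional calculus of \<open>1 / x\<close> with the matrix inverse,
  which can then be computed from any congruence, unitary or not.\<close>

lemma mat_fun_inverse:
  assumes "pos_def n A"
  shows "inverse_pair n A (mat_fun (\<lambda>x. 1 / x) A)"
proof -
  from assms obtain U d where U: "unitary n U" and A: "A = cdiag n U d" and d: "\<And>i. i < n \<Longrightarrow> d i > 0"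
    by (rule pos_def_cdiag) blast
  show ?thesis
    using cdiag_inverse[OF inverse_pair_unitary[OF U], of d] d
    by (simp add: A mat_fun_cdiag[OF U] less_imp_neq[symmetric])
qed

text \<open>By uniqueness of inverses both inverses are congruences by the adjoint of
  \<open>R\<close>, with weights \<open>1\<close> and \<open>1 / e i\<close>, and
  \<open>e i \<ge> 1\<close>.\<close>

lemma mat_fun_inverse_antimono:
  assumes X: "pos_def n X" and Y: "pos_def n Y" and le: "X \<le>\<^sub>L Y"
  shows "mat_fun (\<lambda>x. 1 / x) Y \<le>\<^sub>L mat_fun (\<lambda>x. 1 / x) X"
proof -
  from X Y obtain Q R e where Q: "inverse_pair n Q R" and XY: "X = cdiag n Q (\<lambda>_. 1)" "Y = cdiag n Q e"
    and e: "\<And>i. i < n \<Longrightarrow> e i > 0" by (rule pos_def_pair) blast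
  have e1: "e i \<ge> 1" if "i < n" for i using le that by (simp add: XY cdiag_le_iff[OF Q])
  have "mat_fun (\<lambda>x. 1 / x) X = cdiag n (mat_adjoint R) (\<lambda>_. 1)"
    using inverse_pair_unique[OF mat_fun_inverse[OF X]] cdiag_inverse[OF Q, of "\<lambda>_. 1"] by (simp add: XY)
  moreover have "mat_fun (\<lambda>x. 1 / x) Y = cdiag n (mat_adjoint R) (\<lambda>i. 1 / e i)"
    using inverse_pair_unique[OF mat_fun_inverse[OF Y]] cdiag_inverse[OF Q, of e] e
    by (simp add: XY less_imp_neq[symmetric])
  moreover have "mat_adjoint R \<in> carrier_mat n n" using Q by (simp add: inverse_pair_def mat_adjoint_carrier)
  ultimately show ?thesis using e1 e by (simp add: cdiag_le)
qed

lemma mat_fun_pos_def: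
  assumes "pos_def n A" "\<And>t. t > 0 \<Longrightarrow> f t > 0"
  shows "pos_def n (mat_fun f A)"
proof -
  from assms(1) obtain U d where U: "unitary n U" and A: "A = cdiag n U d" and d: "\<And>i. i < n \<Longrightarrow> d i > 0"
    by (rule pos_def_cdiag) blast
  then show ?thesis using assms(2)
    by (simp add: mat_fun_cdiag[OF U] cdiag_pos_def_iff[OF inverse_pair_unitary[OF U]])
qed

lemma mat_fun_cong:
  assumes "pos_def n A" "\<And>t. t > 0 \<Longrightarrow> f t = g t"
  shows "mat_fun f A = mat_fun g A"
proof -
  from assms(1) obtain U d where U: "unitary n U" and A: "A = cdiag n U d" and d: "\<And>i. i < n \<Longrightarrow> d i > 0"
    by (rule pos_def_cdiag) blast
  have "cdiag n U (\<lambda>i. f (d i)) = cdiag n U (\<lambda>i. g (d i))"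
    by (rule cdiag_cong) (simp add: assms(2) d)
  then show ?thesis by (simp add: A mat_fun_cdiag[OF U])
qed

lemma operator_monotone_arithmetic: "operator_monotone (\<lambda>t. (1 + t) / 2)"
proof -
  have "(\<lambda>t::real. (1 + t) / 2) = (\<lambda>t. 1 / 2 + 1 / 2 * t)" by (simp add: fun_eq_iff add_divide_distrib)
  moreover have "operator_monotone (\<lambda>t. 1 / 2 + 1 / 2 * t)"
    unfolding operator_monotone_def
  proof (intro allI impI)
    fix n X Y assume "pos_def n X" "pos_def n Y" "X \<le>\<^sub>L Y"
    then show "mat_fun (\<lambda>t. 1 / 2 + 1 / 2 * t) X \<le>\<^sub>L mat_fun (\<lambda>t. 1 / 2 + 1 / 2 * t) Y"
      by (intro mat_fun_affine_mono(1)[of X Y n]) (simp_all add: pos_def_def)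
  qed
  ultimately show ?thesis by simp
qed

text \<open>Uses \<open>2 * t / (1 + t) = 2 - 2 / (1 + t)\<close>: an increasing affine map, then
  the order-reversing inverse, then a decreasing affine map.\<close>

lemma operator_monotone_harmonic: "operator_monotone (\<lambda>t. 2 * t / (1 + t))"
  unfolding operator_monotone_def
proof (intro allI impI)
  fix n X Y assume X: "pos_def n X" and Y: "pos_def n Y" and le: "X \<le>\<^sub>L Y"
  \<comment> \<open>The factor \<open>1\<close> is written out to match the affine form
    \<open>a + b * x\<close>.\<close>
  define h :: "real \<Rightarrow> real" where "h t = 1 + 1 * t" for t
  have c: "X \<in> carrier_mat n n" "Y \<in> carrier_mat n n" "hermitian X" "hermitian Y"
    using X Y by (auto simp: pos_def_def)
  have hp: "pos_def n (mat_fun h X)" "pos_def n (mat_fun h Y)"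
    using X Y by (auto intro!: mat_fun_pos_def simp: h_def)
  have hc: "mat_fun h X \<in> carrier_mat n n" "mat_fun h Y \<in> carrier_mat n n"
    "hermitian (mat_fun h X)" "hermitian (mat_fun h Y)"
    using hp by (auto simp: pos_def_def)
  have "mat_fun h X \<le>\<^sub>L mat_fun h Y" unfolding h_def using le c(1,2) by (rule mat_fun_affine_mono(1)) simp
  then have "mat_fun (\<lambda>x. 1 / x) (mat_fun h Y) \<le>\<^sub>L mat_fun (\<lambda>x. 1 / x) (mat_fun h X)"
    by (rule mat_fun_inverse_antimono[OF hp])
  then have *: "mat_fun (\<lambda>x. 1 / h x) Y \<le>\<^sub>L mat_fun (\<lambda>x. 1 / h x) X"
    by (simp add: mat_fun_compose[OF c(1,3)] mat_fun_compose[OF c(2,4)])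
  have neg: "mat_fun (\<lambda>t. 2 * t / (1 + t)) A = mat_fun (\<lambda>x. 2 + (- 2) * x) (mat_fun (\<lambda>x. 1 / h x) A)"
    if "pos_def n A" for A
  proof -
    have "mat_fun (\<lambda>t. 2 * t / (1 + t)) A = mat_fun (\<lambda>x. 2 + (- 2) * (1 / h x)) A"
      by (rule mat_fun_cong[OF that]) (simp add: h_def field_simps)
    then show ?thesis using that by (simp add: pos_def_def mat_fun_compose[of _ n])
  qed
  show "mat_fun (\<lambda>t. 2 * t / (1 + t)) X \<le>\<^sub>L mat_fun (\<lambda>t. 2 * t / (1 + t)) Y"
    unfolding neg[OF X] neg[OF Y]
    by (rule mat_fun_affine_mono(2)[OF *]) (use c in \<open>auto intro: mat_fun_hermitian\<close>)
qed

lemma operator_mean_mean_of: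
  assumes "operator_monotone k" "symmetric_fun k" "k 1 = 1" "\<And>t. t > 0 \<Longrightarrow> k t > 0"
  shows "operator_mean (mean_of k)" "symmetric_mean (mean_of k)"
  using assms mean_of_symmetric[of _ _ _ k] by (auto simp: operator_mean_def symmetric_mean_def)

lemma mean_less_mean_of:
  assumes le: "\<And>t. t > 0 \<Longrightarrow> k t \<le> l t" and neq: "t > 0" "k t \<noteq> l t"
  shows "mean_less (mean_of k) (mean_of l)"
proof -
  let ?A = "cdiag 1 (1\<^sub>m 1) (\<lambda>_. 1)" and ?B = "cdiag 1 (1\<^sub>m 1) (\<lambda>_. t)"
  have "pos_def 1 ?A" "pos_def 1 ?B" "mean_of k ?A ?B \<noteq> mean_of l ?A ?B"
    using neq by (simp_all add: cdiag_pos_def_iff[OF inverse_pair_one] mean_of_cdiag[OF inverse_pair_one]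
        cdiag_eq_iff[OF inverse_pair_one] del: One_nat_def)
  then show ?thesis unfolding mean_less_def
    by (intro conjI exI[of _ 1] exI[of _ ?A] exI[of _ ?B]) (use le in \<open>auto intro: mean_of_mono\<close>)
qed

lemma geometric_mean_eq: "(\<sharp>) = mean_of sqrt"
  by (intro ext) (simp add: geometric_mean_def)

text \<open>The arithmetic mean works: the inequality of arithmetic and geometric means orders two
  positive definite matrices, to which \<open>f\<close> is applied.\<close>

lemma greater_mean_if_operator_monotone:
  assumes "operator_monotone f"
  shows "\<exists>\<sigma>. operator_mean \<sigma> \<and> symmetric_mean \<sigma> \<and> mean_less (\<sharp>) \<sigma> \<and>
    (\<forall>n A B. pos_def n A \<longrightarrow> pos_def n B \<longrightarrow> mat_fun f (A \<sharp> B) \<le>\<^sub>L mat_fun f (\<sigma> A B))"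
proof -
  define k :: "real \<Rightarrow> real" where "k t = (1 + t) / 2" for t
  have pos: "k t > 0" if "t > 0" for t using that by (simp add: k_def)
  have le: "sqrt t \<le> k t" if "t > 0" for t
    using arith_geo_mean_sqrt[of 1 t] that by (simp add: k_def)
  have "operator_mean (mean_of k)" "symmetric_mean (mean_of k)"
    using operator_monotone_arithmetic pos
    by (auto intro!: operator_mean_mean_of simp: symmetric_fun_def k_def[abs_def] field_simps)
  moreover have "mean_less (\<sharp>) (mean_of k)"
    \<comment> \<open>At \<open>t = 4\<close> the representing functions take the values
      \<open>2\<close> and \<open>5 / 2\<close>.\<close>
    unfolding geometric_mean_eq by (rule mean_less_mean_of[of _ _ 4]) (use le in \<open>auto simp: k_def\<close>)
  moreover have "mat_fun f (A \<sharp> B) \<le>\<^sub>L mat_fun f (mean_of k A B)" if "pos_def n A" "pos_def n B" for n A B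
    using assms mean_of_pos_def[OF that, of sqrt] mean_of_pos_def[OF that pos] mean_of_mono[OF that le]
    unfolding operator_monotone_def geometric_mean_def by force
  ultimately show ?thesis by blast
qed

text \<open>Here the harmonic mean is the witness, ordered below the geometric mean.\<close>

lemma less_mean_if_operator_monotone:
  assumes "operator_monotone f"
  shows "\<exists>\<sigma>. operator_mean \<sigma> \<and> symmetric_mean \<sigma> \<and> mean_less \<sigma> (\<sharp>) \<and>
    (\<forall>n A B. pos_def n A \<longrightarrow> pos_def n B \<longrightarrow> mat_fun f (\<sigma> A B) \<le>\<^sub>L mat_fun f (A \<sharp> B))"
proof -
  define k :: "real \<Rightarrow> real" where "k t = 2 * t / (1 + t)" for t
  have pos: "k t > 0" if "t > 0" for t using that by (simp add: k_def)
  have le: "k t \<le> sqrt t" if "t > 0" for t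
  proof -
    \<comment> \<open>Splitting off one factor \<open>sqrt t\<close> reduces the bound to
      \<open>2 * sqrt t \<le> 1 + t\<close>.\<close>
    have "2 * t = sqrt t * (2 * sqrt t)" using that by simp
    also have "\<dots> \<le> sqrt t * (1 + t)"
      using arith_geo_mean_sqrt[of 1 t] that by (intro mult_left_mono) auto
    finally show ?thesis using that by (simp add: k_def pos_divide_le_eq)
  qed
  have "operator_mean (mean_of k)" "symmetric_mean (mean_of k)"
    using operator_monotone_harmonic pos
    by (auto intro!: operator_mean_mean_of simp: symmetric_fun_def k_def[abs_def] field_simps)
  moreover have "mean_less (mean_of k) (\<sharp>)"
    \<comment> \<open>At \<open>t = 4\<close> the values are \<open>8 / 5\<close> and
      \<open>2\<close>.\<close>
    unfolding geometric_mean_eq by (rule mean_less_mean_of[of _ _ 4]) (use le in \<open>auto simp: k_def\<close>)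
  moreover have "mat_fun f (mean_of k A B) \<le>\<^sub>L mat_fun f (A \<sharp> B)" if "pos_def n A" "pos_def n B" for n A B
    using assms mean_of_pos_def[OF that, of sqrt] mean_of_pos_def[OF that pos] mean_of_mono[OF that le]
    unfolding operator_monotone_def geometric_mean_def by force
  ultimately show ?thesis by blast
qed

unused_thms

theorem theorem16:
  fixes f :: "real \<Rightarrow> real"
  assumes "continuous_on {0<..} f"
  shows "(operator_monotone f \<longleftrightarrow>
           (\<exists>\<sigma>. operator_mean \<sigma> \<and> symmetric_mean \<sigma> \<and> mean_less (\<sharp>) \<sigma> \<and>
              (\<forall>n A B. pos_def n A \<longrightarrow> pos_def n B \<longrightarrow>
                 mat_fun f (A \<sharp> B) \<le>\<^sub>L mat_fun f (\<sigma> A B)))) \<and>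
         (operator_monotone f \<longleftrightarrow>
           (\<exists>\<sigma>. operator_mean \<sigma> \<and> symmetric_mean \<sigma> \<and> mean_less \<sigma> (\<sharp>) \<and>
              (\<forall>n A B. pos_def n A \<longrightarrow> pos_def n B \<longrightarrow>
                 mat_fun f (\<sigma> A B) \<le>\<^sub>L mat_fun f (A \<sharp> B))))"
  using greater_mean_if_operator_monotone[of f] less_mean_if_operator_monotone[of f]
    operator_monotone_if_greater_mean[of _ f] operator_monotone_if_less_mean[of _ f]
  by blast

end
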